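(* Let $\{\mu_i\}_{i\in I}$ be an increasing family of valuations in $\mathcal V$, all of them valuation-transcendental. Let $i_0\in I$ and fix $\overline\mu_{i_0}\in\overline{\mathcal V}$ whose restriction to $K[x]$ is $\mu_{i_0}$. Then there exists an increasing family $\{\overline\mu_i\}_{i\in I}$ of valuations in $\overline{\mathcal V}$, whose member of index $i_0$ is the fixed $\overline\mu_{i_0}$, such that $(\overline\mu_i)_{\mid K[x]}=\mu_i$ for all $i\in I$.
   Context: $(K,v)$ is a valued field, $\overline K$ an algebraic closure of $K$, and $v$ also denotes a fixed extension of $v$ to $\overline K$. Put $\Gamma=v\overline K$ and fix an embedding $\Gamma\hookrightarrow\Lambda$ into a divisible (totally) ordered abelian group $\Lambda$. $\mathcal V$ is the set of all $\Lambda$-valued valuations on $K(x)$ whose restriction to $K$ is $v$, identified with valuations $\mu:K[x]\to\Lambda\cup\{\infty\}$ with $\mu^{-1}(\infty)=\{0\}$ and $\mu_{\mid K}=v$. $\overline{\mathcal V}$ is the set of all $\Lambda$-valued valuations on $\overline K(x)$ whose restriction to $\overline K$ is $v$. Both sets are partially ordered by $\mu\le\eta$ iff $\mu(f)\le\eta(f)$ for all polynomials $f$; $\mu<\eta$ means $\mu\le\eta$ and $\mu\ne\eta$. A family $\{\mu_i\}_{i\in I}$ is increasing if $I$ is a totally ordered set and $\mu_i<\mu_j$ whenever $i<j$. A valuation $\mu\in\mathcal V$ with value group $\Gamma_\mu$ and residue field $k_\mu$ is valuation-transcendental if $\Gamma_\mu/vK$ is not a torsion group or $k_\mu$ is transcendental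 over the residue field $Kv$ of $(K,v)$. *)

theory Defs
  imports
    "HOL-Algebra.Algebraic_Closure_Type"
    "HOL-Library.Lattice_Constructions"
begin

text \<open>The extended value monoid: \<^typ>\<open>'a top\<close> adjoins a greatest element
  \<^const>\<open>top.Top\<close>, playing the role of infinity, which absorbs addition.\<close>

instantiation top :: (plus) plus
begin

definition plus_top :: "'a top \<Rightarrow> 'a top \<Rightarrow> 'a top" where
  "plus_top x y = (case x of top.Top \<Rightarrow> top.Top
     | top.Value a \<Rightarrow> (case y of top.Top \<Rightarrow> top.Top | top.Value b \<Rightarrow> top.Value (a + b)))"

instance ..

end

definition valuation :: "('f::field \<Rightarrow> 'g::linordered_ab_group_add top) \<Rightarrow> bool" where
  "valuation v \<longleftrightarrow>
     (\<forall>a. v a = top.Top \<longleftrightarrow> a = 0) \<and>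
     (\<forall>a b. v (a * b) = v a + v b) \<and>
     (\<forall>a b. min (v a) (v b) \<le> v (a + b))"

text \<open>The valuations on the extension field along \<open>\<phi>\<close> that take values in the
  same group as \<open>v\<close> and restrict to \<open>v\<close>.\<close>

definition valuation_extensions ::
    "('e::field \<Rightarrow> 'f::field) \<Rightarrow> ('e \<Rightarrow> 'g::linordered_ab_group_add top) \<Rightarrow> ('f \<Rightarrow> 'g top) set" where
  "valuation_extensions \<phi> v = {\<mu>. valuation \<mu> \<and> (\<forall>a. \<mu> (\<phi> a) = v a)}"

definition is_algebraic_closure :: "('k::field \<Rightarrow> 'l::alg_closed_field) \<Rightarrow> bool" where
  "is_algebraic_closure \<iota> \<longleftrightarrow>
     \<iota> \<in> ring_hom ring_of_type_algebra ring_of_type_algebra \<and>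
     (\<forall>y. \<exists>p. p \<noteq> 0 \<and> poly (map_poly \<iota> p) y = 0)"

text \<open>The field \<open>F(x)\<close> is the fraction field of \<^typ>\<open>'f poly\<close>.\<close>

definition const_fract :: "'f::field \<Rightarrow> 'f poly fract" where
  "const_fract a = to_fract [:a:]"

text \<open>Valuations on \<open>F(x)\<close> are compared through their values on polynomials only.\<close>

definition val_le ::
    "('f::field poly fract \<Rightarrow> 'g::linordered_ab_group_add top) \<Rightarrow> ('f poly fract \<Rightarrow> 'g top) \<Rightarrow> bool" where
  "val_le \<mu> \<eta> \<longleftrightarrow> (\<forall>f. \<mu> (to_fract f) \<le> \<eta> (to_fract f))"

definition val_less ::
    "('f::field poly fract \<Rightarrow> 'g::linordered_ab_group_add top) \<Rightarrow> ('f poly fract \<Rightarrow> 'g top) \<Rightarrow> bool" where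
  "val_less \<mu> \<eta> \<longleftrightarrow> val_le \<mu> \<eta> \<and> \<mu> \<noteq> \<eta>"

definition increasing_family ::
    "('i::linorder \<Rightarrow> 'f::field poly fract \<Rightarrow> 'g::linordered_ab_group_add top) \<Rightarrow> bool" where
  "increasing_family \<mu> \<longleftrightarrow> (\<forall>i j. i < j \<longrightarrow> val_less (\<mu> i) (\<mu> j))"

definition value_group :: "('f::field \<Rightarrow> 'g::linordered_ab_group_add top) \<Rightarrow> 'g monoid" where
  "value_group v = \<lparr>carrier = {\<gamma>. \<exists>a. v a = top.Value \<gamma>}, monoid.mult = (+), one = 0\<rparr>"

definition torsion_group :: "('a, 'b) monoid_scheme \<Rightarrow> bool" where
  "torsion_group G \<longleftrightarrow> (\<forall>x\<in>carrier G. \<exists>n::nat. n > 0 \<and> x [^]\<^bsub>G\<^esub> n = \<one>\<^bsub>G\<^esub>)"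

definition valuation_ring :: "('f::field \<Rightarrow> 'g::linordered_ab_group_add top) \<Rightarrow> 'f ring" where
  "valuation_ring v = ring_of_type_algebra \<lparr>carrier := {a. top.Value 0 \<le> v a}\<rparr>"

definition valuation_ideal :: "('f::field \<Rightarrow> 'g::linordered_ab_group_add top) \<Rightarrow> 'f set" where
  "valuation_ideal v = {a. top.Value 0 < v a}"

definition residue_field :: "('f::field \<Rightarrow> 'g::linordered_ab_group_add top) \<Rightarrow> 'f set ring" where
  "residue_field v = valuation_ring v Quot valuation_ideal v"

definition residue_class :: "('f::field \<Rightarrow> 'g::linordered_ab_group_add top) \<Rightarrow> 'f \<Rightarrow> 'f set" where
  "residue_class v a = valuation_ideal v +>\<^bsub>valuation_ring v\<^esub> a"

text \<open>If \<open>\<mu>\<close> extends \<open>v\<close> along \<open>\<phi>\<close>, then \<open>residue_class v a \<mapsto> residue_class \<mu> (\<phi> a)\<close>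
  embeds the residue field of \<open>v\<close> into that of \<open>\<mu>\<close>; this is the image of the embedding.\<close>

definition residue_subfield ::
    "('e::field \<Rightarrow> 'f::field) \<Rightarrow> ('e \<Rightarrow> 'g::linordered_ab_group_add top) \<Rightarrow> ('f \<Rightarrow> 'g top) \<Rightarrow> 'f set set" where
  "residue_subfield \<phi> v \<mu> = (\<lambda>a. residue_class \<mu> (\<phi> a)) ` carrier (valuation_ring v)"

text \<open>The residue field extension is transcendental iff some element is
  transcendental (in the sense of \<^const>\<open>ring.transcendental\<close>) over the subfield.\<close>

definition valuation_transcendental ::
    "('k::field \<Rightarrow> 'g::linordered_ab_group_add top) \<Rightarrow> ('k poly fract \<Rightarrow> 'g top) \<Rightarrow> bool" where
  "valuation_transcendental v \<mu> \<longleftrightarrow>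
     \<not> torsion_group (value_group \<mu> Mod carrier (value_group v)) \<or>
     (\<exists>\<xi>\<in>carrier (residue_field \<mu>).
        ring.transcendental (residue_field \<mu>) (residue_subfield const_fract v \<mu>) \<xi>)"

text \<open>For \<open>\<mu>\<close> on \<open>K(x)\<close> and \<open>\<eta>\<close> on the rational function field over the closure:
  the restriction of \<open>\<eta>\<close> to \<open>K[x]\<close> is \<open>\<mu>\<close>.\<close>

definition restricts_to ::
    "('k::field \<Rightarrow> 'l::field) \<Rightarrow> ('l poly fract \<Rightarrow> 'g::linordered_ab_group_add top) \<Rightarrow>
     ('k poly fract \<Rightarrow> 'g top) \<Rightarrow> bool" where
  "restricts_to \<iota> \<eta> \<mu> \<longleftrightarrow> (\<forall>f. \<eta> (to_fract (map_poly \<iota> f)) = \<mu> (to_fract f))"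

end

theory Submission
  imports Defs
begin

text \<open>For \<open>a\<close> in the algebraic closure and a radius \<open>\<gamma>\<close> in the value group, the ball valuation at
  \<open>(a, \<gamma>)\<close> sends \<open>\<Sum>c\<^sub>i(x - a)\<^sup>i\<close> to the minimum of \<open>v'(c\<^sub>i) + i\<gamma>\<close>. It depends only on the ball, smaller
  balls give larger valuations, and the ball valuations below a given one form a chain.

  If \<open>\<nu>\<close> on \<open>K[x]\<close> is valuation-transcendental, witnessed by \<open>f / g\<close>, then any \<open>\<rho> \<le> \<nu>\<close> with the same
  value at \<open>fg\<close> equals \<open>\<nu>\<close>, because every polynomial is algebraic over \<open>K(f / g)\<close>. Hence every extension
  of \<open>\<nu>\<close> to the closure is a ball valuation. Moreover two comparable valuations over the closure with
  the same restriction to \<open>K[x]\<close> coincide, by evaluating minimal polynomials of elements of the closure.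

  Suppose the members of a chain of ball valuations restrict to valuations strictly below \<open>\<nu>\<close>. Take
  \<open>h \<in> K[x]\<close> of least degree whose value stays below \<open>\<nu>(h)\<close> along the whole chain. The balls have a common
  root \<open>c\<close> of \<open>h\<close>, and the ball around \<open>c\<close> on which \<open>h\<close> attains the value \<open>\<nu>(h)\<close> is smaller than all
  members of the chain but still restricts to something below \<open>\<nu>\<close>. So a maximal chain reaches \<open>\<nu>\<close>. The same
  argument with a fixed centre works below a ball valuation whose restriction is above \<open>\<nu>\<close>. No conjugation
  by automorphisms is needed. Extensions can thus be inserted at any missing index, and a maximal
  chain of pairs (index, extension) through the prescribed one has all indices.\<close>

subsection \<open>Arithmetic with an infinite value\<close>

text \<open>Zero is the finite \<open>0\<close>, so extended values form an ordered commutative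
  monoid. Cancellation fails only at infinity, hence the side conditions
  \<open>\<noteq> top.Top\<close> below.\<close>

instantiation top :: (zero) zero
begin

definition zero_top :: "'a top" where
  "zero_top = top.Value 0"

instance ..

end

lemma top_add_simps [simp]:
  "top.Value a + top.Value b = top.Value (a + b)"
  "top.Top + x = top.Top"
  "x + top.Top = (top.Top :: 'a::plus top)"
  by (simp_all add: plus_top_def split: top.splits)

instance top :: (comm_monoid_add) comm_monoid_add
proof
  fix a b c :: "'a top"
  show "a + b + c = a + (b + c)"
    by (cases a; cases b; cases c) (simp_all add: add.assoc)
  show "a + b = b + a"
    by (cases a; cases b) (simp_all add: add.commute)
  show "0 + a = a"
    by (cases a) (simp_all add: zero_top_def)
qed

instance top :: (ordered_comm_monoid_add) ordered_comm_monoid_add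
proof
  fix a b c :: "'a top"
  assume "a \<le> b"
  then show "c + a \<le> c + b"
    by (cases a; cases b; cases c) (simp_all add: add_left_mono)
qed

lemma Top_le_iff [simp]: "top.Top \<le> (x :: 'a::order top) \<longleftrightarrow> x = top.Top"
  by (cases x) simp_all

lemma less_Top_iff: "(x :: 'a::order top) < top.Top \<longleftrightarrow> x \<noteq> top.Top"
  by (cases x) simp_all

lemma top_add_eq_Top [simp]: "x + y = top.Top \<longleftrightarrow> x = top.Top \<or> y = (top.Top :: 'a::plus top)"
  by (cases x; cases y) simp_all

lemma zero_neq_Top [simp]: "0 \<noteq> (top.Top :: 'a::zero top)" "top.Top \<noteq> (0 :: 'a::zero top)"
  by (simp_all add: zero_top_def)

context
  fixes a b c d :: "'g::linordered_ab_group_add top"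
begin

lemma top_add_left_cancel: "c \<noteq> top.Top \<Longrightarrow> c + a = c + b \<longleftrightarrow> a = b"
  by (cases a; cases b; cases c) simp_all

lemma top_add_right_cancel: "c \<noteq> top.Top \<Longrightarrow> a + c = b + c \<longleftrightarrow> a = b"
  by (cases a; cases b; cases c) simp_all

lemma top_add_le_cancel_right: "c \<noteq> top.Top \<Longrightarrow> a + c \<le> b + c \<longleftrightarrow> a \<le> b"
  by (cases a; cases b; cases c) simp_all

lemma top_add_less_cancel_left: "c \<noteq> top.Top \<Longrightarrow> c + a < c + b \<longleftrightarrow> a < b"
  by (cases a; cases b; cases c) simp_all

lemma top_add_less_cancel_right: "c \<noteq> top.Top \<Longrightarrow> a + c < b + c \<longleftrightarrow> a < b"
  by (cases a; cases b; cases c) simp_all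

lemma top_add_less_le_mono: "a < b \<Longrightarrow> c \<le> d \<Longrightarrow> c \<noteq> top.Top \<Longrightarrow> a + c < b + d"
  by (cases a; cases b; cases c; cases d) (simp_all add: add_less_le_mono)

lemma top_add_le_less_mono: "a \<le> b \<Longrightarrow> c < d \<Longrightarrow> a \<noteq> top.Top \<Longrightarrow> a + c < b + d"
  by (cases a; cases b; cases c; cases d) (simp_all add: add_le_less_mono)

end

text \<open>A strict gap in one finite summand would survive in the sum. This recovers the values of
  two factors from that of their product when the factors are comparable in advance.\<close>

lemma top_add_eq_imp_eq:
  fixes a b c d :: "'g::linordered_ab_group_add top"
  assumes "a \<le> c" "b \<le> d" "a + b = c + d" "a \<noteq> top.Top" "b \<noteq> top.Top"
  shows "a = c" "b = d"
proof -
  have "\<not> a < c"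
    using top_add_less_le_mono[of a c b d] assms by (metis less_irrefl)
  with \<open>a \<le> c\<close> show "a = c"
    by (metis order.not_eq_order_implies_strict)
  then show "b = d"
    using assms by (simp add: top_add_left_cancel)
qed

lemma top_diff_exists: "b \<noteq> top.Top \<Longrightarrow> \<exists>t. t + b = (a :: 'g::ab_group_add top)"
proof (cases a; cases b)
  fix x y
  assume "a = top.Value x" "b = top.Value y"
  then show ?thesis
    by (intro exI[of _ "top.Value (x - y)"]) simp
qed auto

text \<open>A sum over \<open>k<n\<close> matches the form of the divisibility hypothesis.\<close>

definition ntimes :: "nat \<Rightarrow> 'a::comm_monoid_add \<Rightarrow> 'a" where
  "ntimes n x = (\<Sum>k<n. x)"

lemma ntimes_simps [simp]: "ntimes 0 x = 0" "ntimes (Suc n) x = ntimes n x + x"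
  by (simp_all add: ntimes_def)

lemma ntimes_add: "ntimes (m + n) x = ntimes m x + ntimes n x"
  by (induction n) (simp_all add: add_ac)

lemma ntimes_Value: "ntimes n (top.Value x) = top.Value (ntimes n x)"
  by (induction n) (simp_all add: zero_top_def)

lemma ntimes_neq_Top [simp]: "x \<noteq> top.Top \<Longrightarrow> ntimes n x \<noteq> (top.Top :: 'a::comm_monoid_add top)"
  by (induction n) simp_all

lemma ntimes_mono: "x \<le> y \<Longrightarrow> ntimes n x \<le> ntimes n (y :: 'a::ordered_comm_monoid_add)"
  unfolding ntimes_def by (rule sum_mono)

lemma ntimes_strict_mono:
  "(x :: 'g::linordered_ab_group_add) < y \<Longrightarrow> n > 0 \<Longrightarrow> ntimes n x < ntimes n y"
  unfolding ntimes_def by (rule sum_strict_mono) auto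

subsection \<open>Valuations on integral domains\<close>

locale ring_valuation =
  fixes w :: "'a::idom \<Rightarrow> 'g::linordered_ab_group_add top"
  assumes eq_Top_iff: "w a = top.Top \<longleftrightarrow> a = 0"
    and mult: "w (a * b) = w a + w b"
    and add_ge: "min (w a) (w b) \<le> w (a + b)"
begin

lemma zero [simp]: "w 0 = top.Top"
  by (simp add: eq_Top_iff)

lemma one [simp]: "w 1 = 0"
proof -
  have "w 1 + w 1 = w 1 + 0"
    by (simp flip: mult)
  then show ?thesis
    by (subst (asm) top_add_left_cancel) (simp_all add: eq_Top_iff)
qed

lemma minus_one: "w (- 1) = 0"
proof -
  have "w (- 1) + w (- 1) = 0"
    by (simp flip: mult)
  then obtain x where x: "w (- 1) = top.Value x" "x + x = 0"
    by (cases "w (- 1)") (auto simp: zero_top_def)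
  then have "x = 0"
    by (metis double_zero)
  then show ?thesis
    by (simp add: x zero_top_def)
qed

lemma uminus [simp]: "w (- a) = w a"
  using mult[of "-1" a] by (simp add: minus_one)

lemma diff_ge: "min (w a) (w b) \<le> w (a - b)"
  using add_ge[of a "- b"] by simp

lemma diff_commute: "w (a - b) = w (b - a)"
  using uminus[of "a - b"] by simp

lemma power: "w (a ^ n) = ntimes n (w a)"
  by (induction n) (simp_all add: mult add.commute)

lemma add_eq_left: "w a < w b \<Longrightarrow> w (a + b) = w a"
  using add_ge[of a b] diff_ge[of "a + b" b]
  by (auto simp: min_def split: if_splits)

lemma add_eq_right: "w b < w a \<Longrightarrow> w (a + b) = w b"
  using add_eq_left[of b a] by (simp add: add.commute)

lemma add_eq_min: "w a \<noteq> w b \<Longrightarrow> w (a + b) = min (w a) (w b)"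
  using add_eq_left[of a b] add_eq_right[of b a] by (auto simp: min_def)

lemma diff_eq_right: "w b < w a \<Longrightarrow> w (a - b) = w b"
  using add_eq_right[of "- b" a] by simp

text \<open>The offset \<open>s\<close> carries the common weight of all products contributing to
  one coefficient; without a weight it is \<open>0\<close>.\<close>

lemma sum_ge: "(\<And>i. i \<in> S \<Longrightarrow> t \<le> w (f i) + s) \<Longrightarrow> t \<le> w (sum f S) + s"
proof (induction S rule: infinite_finite_induct)
  case (insert x F)
  have "t \<le> w (f x) + s" "t \<le> w (sum f F) + s"
    using insert by auto
  then have "t \<le> min (w (f x)) (w (sum f F)) + s"
    by (simp add: min_def)
  also have "\<dots> \<le> w (f x + sum f F) + s"
    by (intro add_right_mono add_ge)
  finally show ?case
    using insert by simp
qed simp_all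

lemma sum_greater:
  "(\<And>i. i \<in> S \<Longrightarrow> t < w (f i) + s) \<Longrightarrow> t \<noteq> top.Top \<Longrightarrow> t < w (sum f S) + s"
proof (induction S rule: infinite_finite_induct)
  case (insert x F)
  have "t < w (f x) + s" "t < w (sum f F) + s"
    using insert by auto
  then have "t < min (w (f x)) (w (sum f F)) + s"
    by (simp add: min_def)
  also have "\<dots> \<le> w (f x + sum f F) + s"
    by (intro add_right_mono add_ge)
  finally show ?case
    using insert by simp
qed (simp_all add: less_Top_iff)

end

lemma valuation_iff_ring_valuation: "valuation v \<longleftrightarrow> ring_valuation v"
  unfolding valuation_def ring_valuation_def by blast

subsection \<open>Gauss and ball valuations\<close>

definition taylor_term :: "('l::field \<Rightarrow> 'g::linordered_ab_group_add top) \<Rightarrow> 'g \<Rightarrow> 'l poly \<Rightarrow> nat \<Rightarrow> 'g top" where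
  "taylor_term v \<delta> p i = v (coeff p i) + ntimes i (top.Value \<delta>)"

text \<open>The index \<open>0\<close> always occurs, so the minimum is over a nonempty set and the
  zero polynomial gets the value infinity.\<close>

definition gauss :: "('l::field \<Rightarrow> 'g::linordered_ab_group_add top) \<Rightarrow> 'g \<Rightarrow> 'l poly \<Rightarrow> 'g top" where
  "gauss v \<delta> p = Min (taylor_term v \<delta> p ` {..degree p})"

text \<open>For the Taylor expansion of \<open>p\<close> at \<open>a\<close>, the lead index is the number of roots of \<open>p\<close>, with multiplicity,
  in the ball of radius \<open>\<delta>\<close> around \<open>a\<close>.\<close>

definition lead_index :: "('l::field \<Rightarrow> 'g::linordered_ab_group_add top) \<Rightarrow> 'g \<Rightarrow> 'l poly \<Rightarrow> nat \<Rightarrow> bool" where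
  "lead_index v \<delta> p i \<longleftrightarrow>
     taylor_term v \<delta> p i = gauss v \<delta> p \<and> (\<forall>k>i. gauss v \<delta> p < taylor_term v \<delta> p k)"

lemma pcompose_eq_sum: "pcompose p q = (\<Sum>i\<le>degree p. [:coeff p i:] * q ^ i)"
proof -
  have "degree (map_poly (\<lambda>x. [:x:]) p) = degree p"
    by (rule degree_map_poly) simp
  then show ?thesis
    by (simp add: pcompose_altdef poly_altdef coeff_map_poly)
qed

locale gauss_setup = v: ring_valuation v
  for v :: "'l::field \<Rightarrow> 'g::linordered_ab_group_add top"
begin

lemma taylor_term_eq_Top: "taylor_term v \<delta> p i = top.Top \<longleftrightarrow> coeff p i = 0"
  by (simp add: taylor_term_def v.eq_Top_iff)

lemma gauss_le: "gauss v \<delta> p \<le> taylor_term v \<delta> p i"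
proof (cases "i \<le> degree p")
  case True
  then show ?thesis
    unfolding gauss_def by (intro Min_le) auto
next
  case False
  then have "taylor_term v \<delta> p i = top.Top"
    by (simp add: coeff_eq_0 taylor_term_eq_Top)
  then show ?thesis
    by simp
qed

lemma gauss_attained: "\<exists>i\<le>degree p. gauss v \<delta> p = taylor_term v \<delta> p i"
proof -
  have "gauss v \<delta> p \<in> taylor_term v \<delta> p ` {..degree p}"
    unfolding gauss_def by (rule Min_in) auto
  then show ?thesis
    by auto
qed

lemma gauss_ge: "(\<And>i. t \<le> taylor_term v \<delta> p i) \<Longrightarrow> t \<le> gauss v \<delta> p"
  using gauss_attained[of p \<delta>] by metis

lemma gauss_greater: "(\<And>i. t < taylor_term v \<delta> p i) \<Longrightarrow> t < gauss v \<delta> p"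
  using gauss_attained[of p \<delta>] by metis

lemma gauss_eq_Top: "gauss v \<delta> p = top.Top \<longleftrightarrow> p = 0"
proof
  assume "gauss v \<delta> p = top.Top"
  then have "taylor_term v \<delta> p (degree p) = top.Top"
    using gauss_le[of \<delta> p "degree p"] by simp
  then show "p = 0"
    by (simp add: taylor_term_eq_Top)
next
  assume "p = 0"
  then show "gauss v \<delta> p = top.Top"
    using gauss_attained[of p \<delta>] by (metis coeff_0 taylor_term_eq_Top)
qed

lemma gauss_add: "min (gauss v \<delta> p) (gauss v \<delta> q) \<le> gauss v \<delta> (p + q)"
proof (rule gauss_ge)
  fix i
  have "min (gauss v \<delta> p) (gauss v \<delta> q) \<le> min (taylor_term v \<delta> p i) (taylor_term v \<delta> q i)"
    by (intro min.mono gauss_le)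
  also have "\<dots> = min (v (coeff p i)) (v (coeff q i)) + ntimes i (top.Value \<delta>)"
    unfolding taylor_term_def by (auto simp: min_def top_add_le_cancel_right)
  also have "\<dots> \<le> taylor_term v \<delta> (p + q) i"
    unfolding taylor_term_def coeff_add by (intro add_right_mono v.add_ge)
  finally show "min (gauss v \<delta> p) (gauss v \<delta> q) \<le> taylor_term v \<delta> (p + q) i" .
qed

lemma lead_index_exists:
  assumes "p \<noteq> 0"
  shows "\<exists>i\<le>degree p. lead_index v \<delta> p i"
proof -
  let ?S = "{i. i \<le> degree p \<and> taylor_term v \<delta> p i = gauss v \<delta> p}"
  have fin: "finite ?S" and ne: "?S \<noteq> {}"
    using gauss_attained[of p \<delta>] by auto
  have "Max ?S \<in> ?S"
    using Max_in[OF fin ne] .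
  moreover have "gauss v \<delta> p < taylor_term v \<delta> p k" if "k > Max ?S" for k
  proof (cases "k \<le> degree p")
    case True
    then have "taylor_term v \<delta> p k \<noteq> gauss v \<delta> p"
      using that Max_ge[OF fin, of k] by (simp add: not_le[symmetric]) blast
    then show ?thesis
      using gauss_le[of \<delta> p k] by simp
  next
    case False
    then have "taylor_term v \<delta> p k = top.Top"
      by (simp add: coeff_eq_0 taylor_term_eq_Top)
    then show ?thesis
      using gauss_eq_Top[of \<delta> p] assms by (simp add: less_Top_iff)
  qed
  ultimately show ?thesis
    unfolding lead_index_def by blast
qed

lemma lead_index_unique: "lead_index v \<delta> p i \<Longrightarrow> lead_index v \<delta> p j \<Longrightarrow> i = j"
  unfolding lead_index_def by (metis less_irrefl linorder_neqE_nat)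

text \<open>Gauss's lemma. In degree \<open>i + j\<close>, every product other than that of the two
  lead coefficients has an index beyond \<open>i\<close> or beyond \<open>j\<close>, so its value is
  strictly larger and the lead product cannot cancel.\<close>

lemma gauss_lead_index_mult:
  assumes i: "lead_index v \<delta> p i" and j: "lead_index v \<delta> q j" and "p \<noteq> 0" "q \<noteq> 0"
  shows "gauss v \<delta> (p * q) = gauss v \<delta> p + gauss v \<delta> q" "lead_index v \<delta> (p * q) (i + j)"
proof -
  let ?n = "\<lambda>i. ntimes i (top.Value \<delta>)"
  let ?G = "gauss v \<delta> p + gauss v \<delta> q"
  have G: "?G \<noteq> top.Top" and Gp: "gauss v \<delta> p \<noteq> top.Top" and Gq: "gauss v \<delta> q \<noteq> top.Top"
    using assms by (simp_all add: gauss_eq_Top)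
  have term_eq: "v (coeff p k * coeff q (n - k)) + ?n n = taylor_term v \<delta> p k + taylor_term v \<delta> q (n - k)"
    if "k \<le> n" for k n
    using that ntimes_add[of k "n - k" "top.Value \<delta>"]
    by (simp add: taylor_term_def v.mult add_ac)
  have ge: "?G \<le> taylor_term v \<delta> (p * q) n" for n
    unfolding taylor_term_def coeff_mult
    by (rule v.sum_ge) (simp add: term_eq add_mono gauss_le)
  have strict: "?G < v (coeff p k * coeff q (n - k)) + ?n n" if "k \<le> n" "k > i \<or> n - k > j" for k n
  proof -
    have "?G < taylor_term v \<delta> p k + taylor_term v \<delta> q (n - k)"
      using that(2)
    proof
      assume "k > i"
      then show ?thesis
        using i gauss_le[of \<delta> q "n - k"] Gq unfolding lead_index_def
        by (intro top_add_less_le_mono) auto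
    next
      assume "n - k > j"
      then show ?thesis
        using j gauss_le[of \<delta> p k] Gp unfolding lead_index_def
        by (intro top_add_le_less_mono) auto
    qed
    then show ?thesis
      by (simp add: term_eq that)
  qed
  have above: "?G < taylor_term v \<delta> (p * q) n" if "n > i + j" for n
    unfolding taylor_term_def coeff_mult
    using that by (intro v.sum_greater[OF strict G]) auto
  have lead: "v (coeff p i * coeff q (i + j - i)) + ?n (i + j) = ?G"
    using i j by (subst term_eq) (simp_all add: lead_index_def)
  let ?rest = "\<Sum>k\<in>{..i + j} - {i}. coeff p k * coeff q (i + j - k)"
  have split: "coeff (p * q) (i + j) = coeff p i * coeff q (i + j - i) + ?rest"
    unfolding coeff_mult by (rule sum.remove) auto
  have "?G < v ?rest + ?n (i + j)"
    by (intro v.sum_greater[OF strict G]) auto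
  then have "v (coeff p i * coeff q (i + j - i)) < v ?rest"
    unfolding lead[symmetric] by (subst (asm) top_add_less_cancel_right) simp_all
  then have "v (coeff (p * q) (i + j)) = v (coeff p i * coeff q (i + j - i))"
    unfolding split by (rule v.add_eq_left)
  then have at: "taylor_term v \<delta> (p * q) (i + j) = ?G"
    using lead by (simp add: taylor_term_def)
  show "gauss v \<delta> (p * q) = ?G"
    using gauss_ge[of ?G \<delta> "p * q"] gauss_le[of \<delta> "p * q" "i + j"] ge at by (simp add: order.antisym)
  then show "lead_index v \<delta> (p * q) (i + j)"
    using at above by (simp add: lead_index_def)
qed

lemma gauss_ring_valuation: "ring_valuation (gauss v \<delta>)"
proof
  fix p q :: "'l poly"
  show "gauss v \<delta> p = top.Top \<longleftrightarrow> p = 0"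
    by (rule gauss_eq_Top)
  show "min (gauss v \<delta> p) (gauss v \<delta> q) \<le> gauss v \<delta> (p + q)"
    by (rule gauss_add)
  show "gauss v \<delta> (p * q) = gauss v \<delta> p + gauss v \<delta> q"
  proof (cases "p = 0 \<or> q = 0")
    case True
    then have "gauss v \<delta> p = top.Top \<or> gauss v \<delta> q = top.Top" "gauss v \<delta> (p * q) = top.Top"
      by (auto simp: gauss_eq_Top)
    then show ?thesis
      by auto
  next
    case False
    then show ?thesis
      using lead_index_exists[of p \<delta>] lead_index_exists[of q \<delta>] gauss_lead_index_mult by metis
  qed
qed

lemma gauss_const [simp]: "gauss v \<delta> [:c:] = v c"
  by (simp add: gauss_def taylor_term_def)

lemma gauss_linear: "gauss v \<delta> [:c, 1:] = min (v c) (top.Value \<delta>)"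
proof -
  have "{..Suc 0} = {0, Suc 0}"
    by auto
  then show ?thesis
    by (simp add: gauss_def taylor_term_def)
qed

lemma gauss_mono: "\<gamma> \<le> \<delta> \<Longrightarrow> gauss v \<gamma> p \<le> gauss v \<delta> p"
  by (rule gauss_ge, rule order.trans[OF gauss_le])
    (auto simp: taylor_term_def intro!: add_left_mono ntimes_mono)

text \<open>Each term of the expansion in powers of \<open>q\<close> is bounded below separately. A
  general \<open>q\<close> covers both moving the centre of a ball and substituting one polynomial
  into another.\<close>

lemma gauss_le_pcompose:
  assumes "ring_valuation w" "\<And>c. w [:c:] = v c" "top.Value \<delta> \<le> w q"
  shows "gauss v \<delta> p \<le> w (pcompose p q)"
proof -
  interpret w: ring_valuation w
    by fact
  have "gauss v \<delta> p \<le> w ([:coeff p i:] * q ^ i) + 0" for i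
  proof -
    have "gauss v \<delta> p \<le> v (coeff p i) + ntimes i (top.Value \<delta>)"
      using gauss_le[of \<delta> p i] by (simp add: taylor_term_def)
    also have "\<dots> \<le> v (coeff p i) + ntimes i (w q)"
      by (intro add_left_mono ntimes_mono assms)
    finally show ?thesis
      by (simp only: w.mult w.power assms(2) add_0_right)
  qed
  then have "gauss v \<delta> p \<le> w (\<Sum>i\<le>degree p. [:coeff p i:] * q ^ i) + 0"
    by (rule w.sum_ge)
  then show ?thesis
    by (simp only: pcompose_eq_sum add_0_right)
qed

section \<open>Ball valuations and polynomials dominated by their constant term\<close>

definition ball_val :: "'l \<Rightarrow> 'g \<Rightarrow> 'l poly \<Rightarrow> 'g top" where
  "ball_val a \<delta> p = gauss v \<delta> (pcompose p [:a, 1:])"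

text \<open>The constant term of the Taylor expansion at \<open>a\<close> strictly dominates. Over
  an algebraically closed field this holds when the ball contains no root of \<open>p\<close>, see
  \<open>ball_root_exists\<close>.\<close>

definition ball_unit :: "'l \<Rightarrow> 'g \<Rightarrow> 'l poly \<Rightarrow> bool" where
  "ball_unit a \<delta> p \<longleftrightarrow> lead_index v \<delta> (pcompose p [:a, 1:]) 0"

lemma pcompose_shift_eq_0 [simp]: "pcompose p [:a, 1:] = 0 \<longleftrightarrow> p = (0 :: 'l poly)"
  by (rule pcompose_eq_0_iff) simp

lemma ball_val_ring_valuation: "ring_valuation (ball_val a \<delta>)"
proof -
  interpret g: ring_valuation "gauss v \<delta>"
    by (rule gauss_ring_valuation)
  show ?thesis
    unfolding ball_val_def
    by standard (simp_all add: g.eq_Top_iff pcompose_mult g.mult pcompose_add g.add_ge)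
qed

sublocale ball: ring_valuation "ball_val a \<delta>" for a \<delta>
  by (rule ball_val_ring_valuation)

lemma ball_val_const [simp]: "ball_val a \<delta> [:c:] = v c"
  by (simp add: ball_val_def)

lemma ball_val_linear: "ball_val a \<delta> [:- c, 1:] = min (v (a - c)) (top.Value \<delta>)"
  by (simp add: ball_val_def pcompose_pCons gauss_linear)

lemma ball_val_mono: "\<gamma> \<le> \<delta> \<Longrightarrow> ball_val a \<gamma> p \<le> ball_val a \<delta> p"
  unfolding ball_val_def by (rule gauss_mono)

lemma pcompose_shift_back:
  "pcompose (pcompose p [:a, 1:]) [:c - a, 1:] = pcompose p [:c, 1 :: 'l:]"
  by (simp add: pcompose_assoc[symmetric] pcompose_pCons)

text \<open>Rewriting \<open>p\<close> in powers of \<open>x - a\<close> reduces this minimality of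
  the ball valuation to the bound for substitutions.\<close>

lemma ball_val_le:
  assumes "ring_valuation w" "\<And>c. w [:c:] = v c" "top.Value \<delta> \<le> w [:- a, 1:]"
  shows "ball_val a \<delta> p \<le> w p"
proof -
  have "gauss v \<delta> (pcompose p [:a, 1:]) \<le> w (pcompose (pcompose p [:a, 1:]) [:- a, 1:])"
    by (intro gauss_le_pcompose assms)
  also have "pcompose (pcompose p [:a, 1:]) [:- a, 1:] = p"
    using pcompose_shift_back[of p a 0] by simp
  finally show ?thesis
    by (simp add: ball_val_def)
qed

lemma ball_val_recenter:
  assumes "top.Value \<delta> \<le> v (a - c)"
  shows "ball_val a \<delta> = ball_val c \<delta>"
proof (rule ext, rule order.antisym)
  show "ball_val a \<delta> p \<le> ball_val c \<delta> p" for p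
    using assms by (intro ball_val_le ball_val_ring_valuation) (simp_all add: ball_val_linear v.diff_commute)
  show "ball_val c \<delta> p \<le> ball_val a \<delta> p" for p
    using assms by (intro ball_val_le ball_val_ring_valuation) (simp_all add: ball_val_linear)
qed

lemma ball_val_le_poly: "ball_val a \<delta> p \<le> v (poly p a)"
  using gauss_le[of \<delta> "pcompose p [:a, 1:]" 0] by (simp add: ball_val_def taylor_term_def pcompose_coeff_0)

text \<open>Testing the inequality at \<open>x - a\<close> compares the radii and places
  \<open>c\<close> in the ball around \<open>a\<close>, which may then be centred at
  \<open>c\<close>.\<close>

lemma ball_val_le_imp:
  assumes "ball_val a \<gamma> \<le> ball_val c \<delta>"
  shows "top.Value \<gamma> \<le> v (a - c)" "\<gamma> \<le> \<delta>" "ball_val a \<gamma> = ball_val c \<gamma>"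
proof -
  have "ball_val a \<gamma> [:- a, 1:] \<le> ball_val c \<delta> [:- a, 1:]"
    using assms by (rule le_funD)
  then show *: "top.Value \<gamma> \<le> v (a - c)" "\<gamma> \<le> \<delta>"
    by (simp_all add: ball_val_linear v.diff_commute)
  show "ball_val a \<gamma> = ball_val c \<gamma>"
    using * by (intro ball_val_recenter)
qed

lemma lead_index_ball_exists: "p \<noteq> 0 \<Longrightarrow> \<exists>i. lead_index v \<delta> (pcompose p [:a, 1:]) i"
  using lead_index_exists[of "pcompose p [:a, 1:]" \<delta>] by auto

text \<open>Lead indices add under multiplication, and a sum of natural numbers vanishes only if
  both summands do.\<close>

lemma ball_unit_mult_iff:
  assumes "p \<noteq> 0" "q \<noteq> 0"
  shows "ball_unit a \<delta> (p * q) \<longleftrightarrow> ball_unit a \<delta> p \<and> ball_unit a \<delta> q"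
proof -
  obtain i j where "lead_index v \<delta> (pcompose p [:a, 1:]) i" "lead_index v \<delta> (pcompose q [:a, 1:]) j"
    using assms lead_index_ball_exists by metis
  then show ?thesis
    using gauss_lead_index_mult(2)[of \<delta> "pcompose p [:a, 1:]" i "pcompose q [:a, 1:]" j] assms lead_index_unique
    unfolding ball_unit_def pcompose_mult by (metis add_is_0 pcompose_shift_eq_0)
qed

lemma ball_unit_iff:
  assumes "p \<noteq> 0"
  shows "ball_unit a \<delta> p \<longleftrightarrow> (\<forall>i>0. v (poly p a) < taylor_term v \<delta> (pcompose p [:a, 1:]) i)"
proof -
  let ?p = "pcompose p [:a, 1:]"
  have 0: "taylor_term v \<delta> ?p 0 = v (poly p a)"
    by (simp add: taylor_term_def pcompose_coeff_0)
  show ?thesis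
  proof
    assume "ball_unit a \<delta> p"
    then show "\<forall>i>0. v (poly p a) < taylor_term v \<delta> ?p i"
      using 0 by (simp add: ball_unit_def lead_index_def)
  next
    assume *: "\<forall>i>0. v (poly p a) < taylor_term v \<delta> ?p i"
    have "v (poly p a) \<le> taylor_term v \<delta> ?p i" for i
      using * 0 by (cases "i = 0") (auto intro: less_imp_le)
    then have "v (poly p a) \<le> gauss v \<delta> ?p"
      by (rule gauss_ge)
    then have "gauss v \<delta> ?p = v (poly p a)"
      using gauss_le[of \<delta> ?p 0] 0 by simp
    then show "ball_unit a \<delta> p"
      using * 0 by (simp add: ball_unit_def lead_index_def)
  qed
qed

lemma ball_unit_val: "ball_unit a \<delta> p \<Longrightarrow> ball_val a \<delta> p = v (poly p a)"
  by (simp add: ball_unit_def lead_index_def ball_val_def taylor_term_def pcompose_coeff_0)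

lemma ball_unit_const [simp]: "c \<noteq> 0 \<Longrightarrow> ball_unit a \<delta> [:c:]"
  by (subst ball_unit_iff) (auto simp: taylor_term_def v.eq_Top_iff less_Top_iff coeff_pCons split: nat.splits)

lemma ball_unit_linear: "ball_unit a \<delta> [:- c, 1:] \<longleftrightarrow> v (a - c) < top.Value \<delta>"
proof -
  have "v (a - c) < taylor_term v \<delta> [:a - c, 1:] i" if "v (a - c) < top.Value \<delta>" "i > 0" for i
    using that by (cases i) (auto simp: taylor_term_def coeff_pCons less_Top_iff split: nat.splits)
  moreover have "taylor_term v \<delta> [:a - c, 1:] (Suc 0) = top.Value \<delta>"
    by (simp add: taylor_term_def)
  ultimately have "(\<forall>i>0. v (a - c) < taylor_term v \<delta> [:a - c, 1:] i) \<longleftrightarrow> v (a - c) < top.Value \<delta>"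
    by (metis zero_less_Suc)
  then show ?thesis
    by (subst ball_unit_iff) (simp_all add: pcompose_pCons)
qed

text \<open>Removing the dominating constant term leaves only strictly larger terms.\<close>

lemma ball_unit_diff_const:
  assumes "ball_unit a \<delta> p" "p \<noteq> 0"
  shows "ball_val a \<delta> p < ball_val a \<delta> (p - [:poly p a:])"
proof -
  let ?p = "pcompose p [:a, 1:]"
  have "v (poly p a) < taylor_term v \<delta> (pcompose (p - [:poly p a:]) [:a, 1:]) i" for i
  proof (cases i)
    case 0
    have "v (poly p a) \<noteq> top.Top"
      using assms ball_unit_val ball.eq_Top_iff by metis
    then show ?thesis
      using 0 by (simp add: taylor_term_def pcompose_diff pcompose_coeff_0 less_Top_iff)
  next
    case (Suc j)
    then have "taylor_term v \<delta> (pcompose (p - [:poly p a:]) [:a, 1:]) i = taylor_term v \<delta> ?p i"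
      by (simp add: taylor_term_def pcompose_diff)
    then show ?thesis
      using assms Suc by (simp add: ball_unit_iff)
  qed
  then show ?thesis
    using gauss_greater assms(1) by (simp add: ball_unit_val ball_val_def[of _ _ "p - _"])
qed

text \<open>All Taylor terms of \<open>h\<close> exceed the value of \<open>r\<close>, so the
  constant term of \<open>r\<close> still dominates in the difference.\<close>

lemma ball_unit_diff:
  assumes "ball_unit a \<delta> r" "r \<noteq> 0" "ball_val a \<delta> r < ball_val a \<delta> h"
  shows "ball_unit a \<delta> (h - r)"
proof -
  have w: "ball_val a \<delta> (h - r) = ball_val a \<delta> r"
    using assms by (intro ball.diff_eq_right)
  have ne: "h - r \<noteq> 0"
    using assms by auto
  have r: "v (poly r a) = ball_val a \<delta> r"
    using assms by (simp add: ball_unit_val)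
  have "v (poly (h - r) a) = v (poly r a)"
    using ball_val_le_poly[of a \<delta> h] assms r unfolding poly_diff by (intro v.diff_eq_right) simp
  moreover have "v (poly r a) < taylor_term v \<delta> (pcompose (h - r) [:a, 1:]) i" if "i > 0" for i
  proof -
    let ?t = "\<lambda>p. v (coeff (pcompose p [:a, 1:]) i)" and ?n = "ntimes i (top.Value \<delta>)"
    have "v (poly r a) < ?t h + ?n"
      using assms r gauss_le[of \<delta> "pcompose h [:a, 1:]" i] by (simp add: ball_val_def taylor_term_def)
    moreover have "v (poly r a) < ?t r + ?n"
      using assms that by (simp add: ball_unit_iff taylor_term_def)
    ultimately have "v (poly r a) < min (?t h) (?t r) + ?n"
      by (simp add: min_def)
    also have "\<dots> \<le> ?t (h - r) + ?n"
      unfolding pcompose_diff coeff_diff by (intro add_right_mono v.diff_ge)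
    finally show ?thesis
      by (simp add: taylor_term_def)
  qed
  ultimately show ?thesis
    using ne by (simp add: ball_unit_iff)
qed

text \<open>Only equal values could cancel. But the lead term of \<open>g\<close> has positive
  index, where the term of \<open>r\<close> is strictly larger, so it survives in the sum.\<close>

lemma ball_val_add_nonunit:
  assumes "ball_unit a \<delta> r" "\<not> ball_unit a \<delta> g" "g \<noteq> 0"
  shows "ball_val a \<delta> (g + r) = min (ball_val a \<delta> g) (ball_val a \<delta> r)"
proof (cases "ball_val a \<delta> g = ball_val a \<delta> r")
  case False
  then show ?thesis
    by (rule ball.add_eq_min)
next
  case True
  let ?c = "\<lambda>p. coeff (pcompose p [:a, 1:])"
  obtain i where i: "lead_index v \<delta> (pcompose g [:a, 1:]) i"
    using lead_index_ball_exists assms by metis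
  then have "i > 0"
    using assms by (cases i) (simp_all add: ball_unit_def)
  have g: "v (?c g i) + ntimes i (top.Value \<delta>) = ball_val a \<delta> g"
    using i by (simp add: lead_index_def taylor_term_def ball_val_def)
  have "ball_val a \<delta> r < v (?c r i) + ntimes i (top.Value \<delta>)"
    using assms(1) \<open>i > 0\<close> by (simp add: ball_unit_def lead_index_def taylor_term_def ball_val_def)
  then have "v (?c g i) < v (?c r i)"
    unfolding True[symmetric] g[symmetric] by (subst (asm) top_add_less_cancel_right) simp_all
  then have "v (?c (g + r) i) = v (?c g i)"
    unfolding pcompose_add coeff_add by (rule v.add_eq_left)
  then have "ball_val a \<delta> (g + r) \<le> ball_val a \<delta> g"
    using gauss_le[of \<delta> "pcompose (g + r) [:a, 1:]" i] g by (simp add: ball_val_def taylor_term_def)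
  then show ?thesis
    using ball.add_ge[of a \<delta> g r] True by simp
qed

end

section \<open>Splitting into linear factors over an algebraically closed field\<close>

locale alg_closed_gauss = gauss_setup v
  for v :: "'l::alg_closed_field \<Rightarrow> 'g::linordered_ab_group_add top"
begin

lemma poly_linear_factor_induct [consumes 1, case_names const linear]:
  fixes p :: "'l poly"
  assumes "p \<noteq> 0" "\<And>c. c \<noteq> 0 \<Longrightarrow> P [:c:]" "\<And>c q. q \<noteq> 0 \<Longrightarrow> P q \<Longrightarrow> P ([:- c, 1:] * q)"
  shows "P p"
  using assms(1)
proof (induction "degree p" arbitrary: p)
  case 0
  then obtain c where "p = [:c:]"
    using degree_eq_zeroE by metis
  then show ?case
    using 0 assms(2) by simp
next
  case (Suc n)
  then obtain c where "poly p c = 0"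
    using alg_closed_imp_poly_has_root[of p] by auto
  then obtain q where p: "p = [:- c, 1:] * q"
    by (auto simp: poly_eq_0_iff_dvd)
  then have q: "q \<noteq> 0"
    using Suc by auto
  then have "degree p = Suc (degree q)"
    unfolding p by (subst degree_mult_eq) simp_all
  then have "P q"
    using Suc q by simp
  then show ?case
    unfolding p using q by (rule assms(3)[rotated])
qed

text \<open>Some linear factor of \<open>p\<close> is not dominated by its constant term, and its
  root lies in the ball.\<close>

lemma ball_root_exists:
  assumes "\<not> ball_unit a \<delta> p" "p \<noteq> 0"
  shows "\<exists>c. poly p c = 0 \<and> top.Value \<delta> \<le> v (a - c)"
  using assms(2,1)
proof (induction p rule: poly_linear_factor_induct)
  case (const c)
  then show ?case
    by simp
next
  case (linear c q)
  then have "\<not> ball_unit a \<delta> [:- c, 1:] \<or> \<not> ball_unit a \<delta> q"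
    by (subst (asm) ball_unit_mult_iff) auto
  then show ?case
  proof
    assume "\<not> ball_unit a \<delta> [:- c, 1:]"
    then show ?thesis
      by (auto simp: ball_unit_linear not_less intro!: exI[of _ c])
  next
    assume "\<not> ball_unit a \<delta> q"
    then show ?thesis
      using linear by auto
  qed
qed

lemma ring_valuation_eq_on_roots:
  assumes w: "ring_valuation w" "ring_valuation w'" "\<And>c. w [:c:] = w' [:c:]"
    and p: "p \<noteq> (0 :: 'l poly)" "\<And>c. poly p c = 0 \<Longrightarrow> w [:- c, 1:] = w' [:- c, 1:]"
  shows "w p = w' p"
  using p
proof (induction p rule: poly_linear_factor_induct)
  case (const c)
  then show ?case
    by (simp add: w)
next
  case (linear c q)
  then have "w q = w' q" "w [:- c, 1:] = w' [:- c, 1:]"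
    by auto
  then show ?case
    using w(1,2) by (simp only: ring_valuation.mult)
qed

end

subsection \<open>Comparable valuations\<close>

locale valuation_le =
  \<rho>: ring_valuation \<rho> + \<nu>: ring_valuation \<nu>
  for \<rho> \<nu> :: "'a::idom \<Rightarrow> 'g::linordered_ab_group_add top" +
  assumes le: "\<rho> a \<le> \<nu> a"
begin

text \<open>If the value of the sum exceeded that of \<open>Q\<close>, both summands would have
  equal values, under \<rho> and likewise under \<nu>. Then \<open>\<psi> * S\<close> would have the
  same value under both, although \<psi> gains strictly and \<open>S\<close> cannot lose.\<close>

lemma val_add_mult_le:
  assumes \<psi>: "\<rho> \<psi> < \<nu> \<psi>" and Q: "\<rho> Q = \<nu> Q"
  shows "\<rho> (Q + \<psi> * S) \<le> \<rho> Q"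
proof (rule ccontr)
  assume "\<not> ?thesis"
  then have less: "\<rho> Q < \<rho> (Q + \<psi> * S)"
    by simp
  have *: "\<psi> * S = (Q + \<psi> * S) - Q"
    by simp
  have "\<rho> (\<psi> * S) = \<rho> Q"
    using less by (subst *) (rule \<rho>.diff_eq_right)
  moreover have "\<nu> (\<psi> * S) = \<nu> Q"
    using less le[of "Q + \<psi> * S"] Q by (subst *) (rule \<nu>.diff_eq_right, simp)
  ultimately have eq: "\<rho> \<psi> + \<rho> S = \<nu> \<psi> + \<nu> S" and fin: "\<rho> \<psi> + \<rho> S \<noteq> top.Top"
    using Q less by (auto simp flip: \<rho>.mult \<nu>.mult)
  from fin have "\<rho> \<psi> \<noteq> top.Top" "\<rho> S \<noteq> top.Top"
    by auto
  then show False
    using top_add_eq_imp_eq(1)[OF le[of \<psi>] le[of S] eq] \<psi> by auto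
qed

text \<open>Horner's scheme: splitting off \<open>Q 0\<close> leaves a multiple of \<psi>, to which
  \<open>val_add_mult_le\<close> applies. With the ultrametric inequality, the value of a
  \<psi>-expansion is thus the minimum over its terms.\<close>

lemma val_sum_powers_le:
  assumes \<psi>: "\<rho> \<psi> < \<nu> \<psi>" and Q: "\<And>j. j \<le> n \<Longrightarrow> \<rho> (Q j) = \<nu> (Q j)" and "j \<le> n"
  shows "\<rho> (\<Sum>i\<le>n. Q i * \<psi> ^ i) \<le> \<rho> (Q j * \<psi> ^ j)"
  using Q \<open>j \<le> n\<close>
proof (induction n arbitrary: Q j)
  case 0
  then show ?case
    by simp
next
  case (Suc n)
  define S where "S = (\<Sum>i\<le>n. Q (Suc i) * \<psi> ^ i)"
  have sum: "(\<Sum>i\<le>Suc n. Q i * \<psi> ^ i) = Q 0 + \<psi> * S"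
    by (subst sum.atMost_Suc_shift) (simp add: S_def sum_distrib_left mult_ac)
  have le0: "\<rho> (Q 0 + \<psi> * S) \<le> \<rho> (Q 0)"
    by (intro val_add_mult_le \<psi> Suc.prems) simp
  show ?case
  proof (cases j)
    case 0
    then show ?thesis
      unfolding sum using le0 by simp
  next
    case (Suc i)
    \<comment> \<open>The sum has value at most that of \<open>Q 0\<close>, so subtracting
      \<open>Q 0\<close> from it cannot lower the value.\<close>
    have "\<rho> (Q 0 + \<psi> * S) \<le> \<rho> (\<psi> * S)"
      using \<rho>.diff_ge[of "Q 0 + \<psi> * S" "Q 0"] le0 by simp
    also have "\<dots> \<le> \<rho> \<psi> + \<rho> (Q j * \<psi> ^ i)"
      using Suc.IH[of "\<lambda>i. Q (Suc i)" i] Suc.prems Suc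
      by (auto simp: S_def \<rho>.mult intro: add_left_mono)
    also have "\<dots> = \<rho> (Q j * \<psi> ^ j)"
      by (simp add: Suc \<rho>.mult add_ac)
    finally show ?thesis
      unfolding sum .
  qed
qed

end

text \<open>Gaussian elimination on the top coefficient. An indexed family lets repeated polynomials
  count as dependent; bounding coefficients instead of degrees makes the base case the zero
  polynomial.\<close>

lemma poly_linear_dependence:
  fixes F :: "'i \<Rightarrow> 'a::field poly"
  assumes "finite S" "card S > n" "\<And>i m. i \<in> S \<Longrightarrow> m \<ge> n \<Longrightarrow> coeff (F i) m = 0"
  shows "\<exists>c. (\<exists>i\<in>S. c i \<noteq> 0) \<and> (\<Sum>i\<in>S. smult (c i) (F i)) = 0"
  using assms
proof (induction n arbitrary: S F)
  case 0
  then obtain i where "i \<in> S"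
    by fastforce
  moreover have "F i = 0" if "i \<in> S" for i
    using 0 that by (simp add: poly_eq_iff)
  ultimately show ?case
    by (intro exI[of _ "\<lambda>_. 1"]) auto
next
  case (Suc n)
  show ?case
  proof (cases "\<forall>i\<in>S. coeff (F i) n = 0")
    case True
    have "coeff (F i) m = 0" if "i \<in> S" "m \<ge> n" for i m
      using that True Suc.prems(3)[of i m] by (cases "m = n") auto
    then show ?thesis
      using Suc.IH[of S F] Suc.prems by simp
  next
    case False
    then obtain p where p: "p \<in> S" "coeff (F p) n \<noteq> 0"
      by auto
    \<comment> \<open>\<open>p\<close> is the pivot; subtracting these multiples clears coefficient
      \<open>n\<close> in all other members.\<close>
    define r where "r i = coeff (F i) n / coeff (F p) n" for i
    define F' where "F' i = F i - smult (r i) (F p)" for i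
    have "coeff (F' i) m = 0" if "i \<in> S - {p}" "m \<ge> n" for i m
      using that p Suc.prems(3)[of i m] Suc.prems(3)[of p m]
      by (cases "m = n") (auto simp: F'_def r_def)
    then obtain c where c: "\<exists>i\<in>S - {p}. c i \<noteq> 0" "(\<Sum>i\<in>S - {p}. smult (c i) (F' i)) = 0"
      using Suc.IH[of "S - {p}" F'] Suc.prems p by (auto simp: less_diff_conv)
    \<comment> \<open>The coefficient at the pivot collects what the elimination subtracted from the
      others.\<close>
    define d where "d i = (if i = p then - (\<Sum>i\<in>S - {p}. c i * r i) else c i)" for i
    have "(\<Sum>i\<in>S. smult (d i) (F i)) = smult (d p) (F p) + (\<Sum>i\<in>S - {p}. smult (d i) (F i))"
      using Suc.prems p by (intro sum.remove)
    also have "(\<Sum>i\<in>S - {p}. smult (d i) (F i)) = (\<Sum>i\<in>S - {p}. smult (c i) (F i))"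
      by (intro sum.cong) (auto simp: d_def)
    also have "smult (d p) (F p) = - (\<Sum>i\<in>S - {p}. smult (c i * r i) (F p))"
      by (simp add: d_def smult_sum)
    also have "\<dots> + (\<Sum>i\<in>S - {p}. smult (c i) (F i)) = (\<Sum>i\<in>S - {p}. smult (c i) (F' i))"
      by (simp add: F'_def smult_diff_right sum_subtractf)
    finally have "(\<Sum>i\<in>S. smult (d i) (F i)) = 0"
      using c by simp
    moreover have "\<exists>i\<in>S. d i \<noteq> 0"
      using c(1) by (auto simp: d_def)
    ultimately show ?thesis
      by blast
  qed
qed

text \<open>A dimension count: the \<open>(D + 1)^2\<close> products
  \<open>f ^ k * g ^ (D - k) * \<psi> ^ j\<close> lie in a space of dimension \<open>D * D\<close>.
  Homogeneity in \<open>f\<close> and \<open>g\<close> expresses an equation for \<psi> over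
  \<open>K(f / g)\<close> without denominators.\<close>

lemma poly_algebraic_dependence:
  fixes f g \<psi> :: "'a::field poly"
  obtains N c where "\<exists>j\<le>N. \<exists>k\<le>N. c j k \<noteq> 0"
    "(\<Sum>j\<le>N. (\<Sum>k\<le>N. [:c j k:] * f ^ k * g ^ (N - k)) * \<psi> ^ j) = 0"
proof -
  \<comment> \<open>One more than the sum of the degrees, so that these products have degree at most
    \<open>D * (D - 1)\<close>.\<close>
  define D where "D = degree f + degree g + degree \<psi> + 1"
  define F where "F = (\<lambda>(j, k). f ^ k * g ^ (D - k) * \<psi> ^ j)"
  let ?S = "{..D} \<times> {..D}"
  have deg: "degree (F (j, k)) \<le> D * (D - 1)" if "j \<le> D" "k \<le> D" for j k
  proof -
    have "degree (F (j, k)) \<le> degree (f ^ k) + degree (g ^ (D - k)) + degree (\<psi> ^ j)"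
      unfolding F_def by (auto intro: order.trans[OF degree_mult_le] add_right_mono degree_mult_le)
    also have "\<dots> \<le> degree f * k + degree g * (D - k) + degree \<psi> * j"
      by (intro add_mono degree_power_le)
    also have "\<dots> \<le> degree f * D + degree g * D + degree \<psi> * D"
      using that by (intro add_mono mult_le_mono) auto
    also have "\<dots> = D * (D - 1)"
      by (simp add: D_def algebra_simps)
    finally show ?thesis .
  qed
  have "coeff (F i) m = 0" if "i \<in> ?S" "m \<ge> D * D" for i m
  proof -
    obtain j k where i: "i = (j, k)"
      by (cases i)
    have "D * (D - 1) < D * D"
      by (simp add: D_def)
    also have "D * D \<le> m"
      by fact
    finally have "degree (F i) < m"
      using that(1) deg[of j k] by (simp add: i)
    then show ?thesis
      by (rule coeff_eq_0)
  qed
  moreover have "card ?S > D * D"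
    by simp
  ultimately obtain c where c: "\<exists>i\<in>?S. c i \<noteq> 0" "(\<Sum>i\<in>?S. smult (c i) (F i)) = 0"
    using poly_linear_dependence[of ?S "D * D" F] by auto
  have "(\<Sum>i\<in>?S. smult (c i) (F i)) = (\<Sum>j\<le>D. \<Sum>k\<le>D. smult (c (j, k)) (F (j, k)))"
    by (simp add: sum.cartesian_product)
  also have "\<dots> = (\<Sum>j\<le>D. (\<Sum>k\<le>D. [:c (j, k):] * f ^ k * g ^ (D - k)) * \<psi> ^ j)"
    by (simp add: F_def sum_distrib_left mult_ac)
  finally show thesis
    using c by (intro that[where c = "\<lambda>j k. c (j, k)" and N = D]) auto
qed

text \<open>Here \<open>\<nu>\<close> is transcendental over \<open>v\<close> at the element \<open>f / g\<close>, stated with denominators cleared.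
  As \<open>\<psi>\<close> is algebraic over \<open>K(f / g)\<close>, its value cannot grow while those of \<open>f\<close> and \<open>g\<close> stay.\<close>

lemma transcendental_val_detects:
  fixes v :: "'k::field \<Rightarrow> 'g::linordered_ab_group_add top" and \<rho> \<nu> :: "'k poly \<Rightarrow> 'g top"
  assumes v: "ring_valuation v"
    and \<rho>: "ring_valuation \<rho>" "\<And>c. \<rho> [:c:] = v c"
    and \<nu>: "ring_valuation \<nu>" "\<And>c. \<nu> [:c:] = v c"
    and le: "\<And>p. \<rho> p \<le> \<nu> p"
    and "f \<noteq> 0" "g \<noteq> 0"
    and trans: "\<And>n c k. k \<le> n \<Longrightarrow> \<nu> (\<Sum>k\<le>n. [:c k:] * f ^ k * g ^ (n - k)) \<le> \<nu> ([:c k:] * f ^ k * g ^ (n - k))"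
    and eq: "\<rho> (f * g) = \<nu> (f * g)"
  shows "\<rho> = \<nu>"
proof (rule ext, rule ccontr)
  fix \<psi>
  assume "\<rho> \<psi> \<noteq> \<nu> \<psi>"
  then have \<psi>: "\<rho> \<psi> < \<nu> \<psi>"
    using le[of \<psi>] by simp
  interpret v: ring_valuation v by fact
  interpret \<rho>: ring_valuation \<rho> by fact
  interpret \<nu>: ring_valuation \<nu> by fact
  interpret valuation_le \<rho> \<nu>
    by standard (rule le)
  have "\<rho> f + \<rho> g = \<nu> f + \<nu> g" "\<rho> f \<noteq> top.Top" "\<rho> g \<noteq> top.Top"
    using eq assms(7,8) by (simp_all add: \<rho>.mult \<nu>.mult \<rho>.eq_Top_iff)
  then have fg: "\<rho> f = \<nu> f" "\<rho> g = \<nu> g"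
    using top_add_eq_imp_eq[OF le[of f] le[of g]] by auto
  obtain N c where c: "\<exists>j\<le>N. \<exists>k\<le>N. c j k \<noteq> 0"
    "(\<Sum>j\<le>N. (\<Sum>k\<le>N. [:c j k:] * f ^ k * g ^ (N - k)) * \<psi> ^ j) = 0"
    by (rule poly_algebraic_dependence)
  define Q where "Q j = (\<Sum>k\<le>N. [:c j k:] * f ^ k * g ^ (N - k))" for j
  \<comment> \<open>Every monomial has the same value under \<rho> and \<nu>, and none lies below
    \<open>\<nu> (Q j)\<close>; so neither does the sum under \<rho>.\<close>
  have "\<rho> (Q j) = \<nu> (Q j)" for j
  proof (rule order.antisym[OF le])
    have "\<nu> (Q j) \<le> \<rho> ([:c j k:] * f ^ k * g ^ (N - k)) + 0" if "k \<in> {..N}" for k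
      using trans[of k N "c j"] that
      by (simp add: Q_def \<rho>.mult \<nu>.mult \<rho>.power \<nu>.power fg \<rho>(2) \<nu>(2) del: mult_pCons_left)
    then have "\<nu> (Q j) \<le> \<rho> (\<Sum>k\<le>N. [:c j k:] * f ^ k * g ^ (N - k)) + 0"
      by (rule \<rho>.sum_ge)
    then show "\<nu> (Q j) \<le> \<rho> (Q j)"
      by (simp only: Q_def[of j, symmetric] add_0_right)
  qed
  then have "\<rho> (\<Sum>i\<le>N. Q i * \<psi> ^ i) \<le> \<rho> (Q j * \<psi> ^ j)" if "j \<le> N" for j
    using that \<psi> by (intro val_sum_powers_le) auto
  \<comment> \<open>The sum is zero, and its infinite value is a lower bound for each term.\<close>
  then have "\<rho> (Q j * \<psi> ^ j) = top.Top" if "j \<le> N" for j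
    using that c(2) by (simp add: Q_def)
  moreover have "\<psi> \<noteq> 0"
    using \<psi> by auto
  ultimately have Q0: "Q j = 0" if "j \<le> N" for j
    using that by (simp add: \<rho>.eq_Top_iff)
  obtain j k where jk: "j \<le> N" "k \<le> N" "c j k \<noteq> 0"
    using c(1) by blast
  \<comment> \<open>With \<open>Q j = 0\<close>, the bound \<open>trans\<close> gives a nonzero
    monomial infinite value.\<close>
  have "\<nu> ([:c j k:] * f ^ k * g ^ (N - k)) = top.Top"
    using trans[of k N "c j"] jk Q0[of j] by (simp add: Q_def del: mult_pCons_left)
  then show False
    using jk assms(7,8) by (simp add: \<nu>.eq_Top_iff)
qed

subsection \<open>Restriction from the algebraic closure\<close>

locale valued_closure = alg_closed_gauss v'
  for v' :: "'l::alg_closed_field \<Rightarrow> 'g::linordered_ab_group_add top" +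
  fixes \<iota> :: "'k::field \<Rightarrow> 'l" and v :: "'k \<Rightarrow> 'g top"
  assumes \<iota>_add: "\<iota> (a + b) = \<iota> a + \<iota> b"
    and \<iota>_mult: "\<iota> (a * b) = \<iota> a * \<iota> b"
    and \<iota>_1: "\<iota> 1 = 1"
    and v'_\<iota>: "v' (\<iota> a) = v a"
    and algebraic: "\<exists>p. p \<noteq> 0 \<and> poly (map_poly \<iota> p) y = 0"
    and divisible: "(n::nat) > 0 \<Longrightarrow> \<exists>\<delta>. (\<Sum>k<n. \<delta>) = (\<gamma> :: 'g)"
begin

abbreviation "lift \<equiv> map_poly \<iota>"

lemma \<iota>_0 [simp]: "\<iota> 0 = 0"
  using \<iota>_add[of 0 0] by (metis add.right_neutral add_left_cancel)

lemma \<iota>_sum: "\<iota> (sum f S) = (\<Sum>i\<in>S. \<iota> (f i))"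
  by (induction S rule: infinite_finite_induct) (simp_all add: \<iota>_add)

lemma \<iota>_eq_0_iff [simp]: "\<iota> a = 0 \<longleftrightarrow> a = 0"
proof
  assume "\<iota> a = 0"
  show "a = 0"
  proof (rule ccontr)
    assume "a \<noteq> 0"
    then have "\<iota> a * \<iota> (inverse a) = 1"
      by (simp add: \<iota>_1 flip: \<iota>_mult)
    then show False
      using \<open>\<iota> a = 0\<close> by simp
  qed
qed simp

lemma lift_add: "lift (p + q) = lift p + lift q"
  by (simp add: poly_eq_iff coeff_map_poly \<iota>_add)

lemma lift_mult: "lift (p * q) = lift p * lift q"
  by (simp add: poly_eq_iff coeff_map_poly coeff_mult \<iota>_sum \<iota>_mult)

lemma lift_eq_0_iff [simp]: "lift p = 0 \<longleftrightarrow> p = 0"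
  by (rule map_poly_eq_0_iff) simp_all

lemma lift_const [simp]: "lift [:c:] = [:\<iota> c:]"
  by (simp add: poly_eq_iff coeff_map_poly coeff_pCons split: nat.splits)

lemma lift_power: "lift (p ^ n) = lift p ^ n"
  by (induction n) (simp_all add: lift_mult \<iota>_1 one_pCons)

lemma lift_sum: "lift (sum f S) = (\<Sum>i\<in>S. lift (f i))"
  by (induction S rule: infinite_finite_induct) (simp_all add: lift_add)

lemma degree_lift [simp]: "degree (lift p) = degree p"
  by (rule degree_map_poly) simp

lemma lift_pcompose: "lift (pcompose p q) = pcompose (lift p) (lift q)"
  by (simp add: pcompose_eq_sum lift_sum lift_mult lift_power coeff_map_poly del: mult_pCons_left)

lemma ring_valuation_v: "ring_valuation v"
proof
  fix a b
  show "v a = top.Top \<longleftrightarrow> a = 0"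
    by (simp add: v.eq_Top_iff flip: v'_\<iota>)
  show "v (a * b) = v a + v b"
    by (simp add: v.mult \<iota>_mult flip: v'_\<iota>)
  show "min (v a) (v b) \<le> v (a + b)"
    using v.add_ge[of "\<iota> a" "\<iota> b"] by (simp add: \<iota>_add flip: v'_\<iota>)
qed

lemma lift_ring_valuation:
  assumes "ring_valuation w"
  shows "ring_valuation (\<lambda>p. w (lift p))"
proof -
  interpret w: ring_valuation w by fact
  show ?thesis
    by standard (simp_all add: w.eq_Top_iff lift_mult w.mult lift_add w.add_ge)
qed

text \<open>Without a root in the ball, \<open>\<phi>\<close> is dominated by the constant \<open>\<phi>(a)\<close>. A nonzero \<open>p \<in> K[x]\<close> with
  \<open>p(\<phi>(a)) = 0\<close> would then give \<open>p(\<phi>)\<close> a larger value than its terms, which \<open>val_sum_powers_le\<close> excludes.\<close>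

lemma ball_root_if_val_less:
  assumes \<nu>: "ring_valuation \<nu>" "\<And>p. ball_val a \<gamma> (lift p) \<le> \<nu> p"
    and less: "ball_val a \<gamma> (lift \<phi>) < \<nu> \<phi>" and \<nu>c: "\<And>c. \<nu> [:c:] = v c"
  shows "\<exists>c. poly (lift \<phi>) c = 0 \<and> top.Value \<gamma> \<le> v' (a - c)"
proof -
  interpret valuation_le "\<lambda>p. ball_val a \<gamma> (lift p)" \<nu>
    using assms lift_ring_valuation[OF ball_val_ring_valuation] by (intro valuation_le.intro valuation_le_axioms.intro)
  have "\<phi> \<noteq> 0"
    using less by auto
  then have \<phi>0: "lift \<phi> \<noteq> 0"
    by simp
  have "\<not> ball_unit a \<gamma> (lift \<phi>)"
  proof
    assume unit: "ball_unit a \<gamma> (lift \<phi>)"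
    \<comment> \<open>The constant that dominates \<open>lift \<phi>\<close> on the ball.\<close>
    define u where "u = poly (lift \<phi>) a"
    obtain \<tau> where \<tau>: "ball_val a \<gamma> (lift \<phi>) = top.Value \<tau>"
      using ball.eq_Top_iff[of a \<gamma> "lift \<phi>"] \<phi>0 by (cases "ball_val a \<gamma> (lift \<phi>)") auto
    have u: "v' u = top.Value \<tau>"
      using unit \<tau> by (simp add: ball_unit_val u_def)
    obtain p where p: "p \<noteq> 0" "poly (lift p) u = 0"
      using algebraic by blast
    then obtain q where q: "lift p = [:- u, 1:] * q"
      by (auto simp: poly_eq_0_iff_dvd)
    then have "q \<noteq> 0"
      using p by auto
    obtain i where i: "i \<le> degree (lift p)" "gauss v' \<tau> (lift p) = taylor_term v' \<tau> (lift p) i"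
      using gauss_attained by blast
    \<comment> \<open>The expansion in powers of \<phi> bounds the value of \<open>p(\<phi>)\<close>
      above by the Gauss value of \<open>p\<close> at radius \<tau>, while the factor
      \<open>\<phi> - u\<close> pushes it strictly beyond that.\<close>
    have "ball_val a \<gamma> (lift (pcompose p \<phi>)) \<le> ball_val a \<gamma> (lift ([:coeff p i:] * \<phi> ^ i))"
      unfolding pcompose_eq_sum using i less
      by (intro val_sum_powers_le[of \<phi> "degree p" "\<lambda>i. [:coeff p i:]" i]) (simp_all add: v'_\<iota> \<nu>c)
    also have "\<dots> = gauss v' \<tau> (lift p)"
      by (simp add: i(2) taylor_term_def lift_mult ball.mult lift_power ball.power coeff_map_poly \<tau> del: mult_pCons_left)
    \<comment> \<open>Since \<open>v' u\<close> is \<tau>, the linear factor with root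
      \<open>u\<close> has Gauss value exactly \<tau>.\<close>
    also have "\<dots> = top.Value \<tau> + gauss v' \<tau> q"
    proof -
      interpret g: ring_valuation "gauss v' \<tau>"
        by (rule gauss_ring_valuation)
      show ?thesis
        unfolding q g.mult by (simp add: gauss_linear u)
    qed
    also have "\<dots> < ball_val a \<gamma> (lift \<phi> - [:u:]) + ball_val a \<gamma> (pcompose q (lift \<phi>))"
    proof (rule top_add_less_le_mono)
      show "top.Value \<tau> < ball_val a \<gamma> (lift \<phi> - [:u:])"
        using ball_unit_diff_const[OF unit \<phi>0] \<tau> by (simp add: u_def)
      show "gauss v' \<tau> q \<le> ball_val a \<gamma> (pcompose q (lift \<phi>))"
        using \<tau> by (intro gauss_le_pcompose ball_val_ring_valuation) auto
      show "gauss v' \<tau> q \<noteq> top.Top"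
        using \<open>q \<noteq> 0\<close> by (simp add: gauss_eq_Top)
    qed
    also have "\<dots> = ball_val a \<gamma> (pcompose (lift p) (lift \<phi>))"
    proof -
      have "pcompose [:- u, 1:] (lift \<phi>) = lift \<phi> - [:u:]"
        by (simp add: pcompose_pCons poly_eq_iff coeff_pCons split: nat.splits)
      then show ?thesis
        unfolding q pcompose_mult ball.mult by simp
    qed
    finally show False
      by (simp add: lift_pcompose)
  qed
  then show ?thesis
    using ball_root_exists \<phi>0 by blast
qed

text \<open>Each \<open>x - c\<close> divides a nonzero lifted polynomial, where both valuations
  agree; as they are comparable on the factors, they agree at \<open>x - c\<close>. Linear factors
  and constants determine a valuation over the closure.\<close>

lemma ring_valuation_rigid:
  assumes w: "ring_valuation w" "ring_valuation w'" "\<And>c. w [:c:] = v' c" "\<And>c. w' [:c:] = v' c"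
    and le: "\<And>p. w p \<le> w' p" and eq: "\<And>p. w (lift p) = w' (lift p)"
  shows "w = w'"
proof
  fix p :: "'l poly"
  interpret w: ring_valuation w by fact
  interpret w': ring_valuation w' by fact
  have linear: "w [:- c, 1:] = w' [:- c, 1:]" for c
  proof -
    obtain p where p: "p \<noteq> 0" "poly (lift p) c = 0"
      using algebraic by blast
    then obtain q where q: "lift p = [:- c, 1:] * q"
      by (auto simp: poly_eq_0_iff_dvd)
    then have "q \<noteq> 0"
      using p by auto
    have "w [:- c, 1:] + w q = w' [:- c, 1:] + w' q"
      using eq[of p] unfolding q w.mult w'.mult .
    then show ?thesis
      using \<open>q \<noteq> 0\<close> by (intro top_add_eq_imp_eq(1)[OF le[of "[:- c, 1:]"] le[of q]]) (simp_all add: w.eq_Top_iff)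
  qed
  show "w p = w' p"
  proof (cases "p = 0")
    case False
    show ?thesis
      by (rule ring_valuation_eq_on_roots[OF w(1,2) _ False linear]) (simp add: w(3,4))
  qed simp
qed

text \<open>On concentric balls the value is a minimum of terms affine in the radius. The constant
  term never drops below \<tau>; by divisibility each other nonzero term reaches \<tau> exactly, and
  \<delta> is the largest radius at which one does.\<close>

lemma ball_val_intermediate:
  assumes "ball_val c \<gamma> p < top.Value \<tau>" "top.Value \<tau> \<le> v' (poly p c)"
  obtains \<delta> where "\<gamma> < \<delta>" "ball_val c \<delta> p = top.Value \<tau>" "\<not> ball_unit c \<delta> p"
    "\<And>\<delta>'. top.Value \<tau> \<le> ball_val c \<delta>' p \<Longrightarrow> \<delta> \<le> \<delta>'"
proof -
  define q where "q = pcompose p [:c, 1:]"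
  let ?T = "\<lambda>\<delta>. taylor_term v' \<delta> q"
  have q0: "?T \<delta> 0 = v' (poly p c)" for \<delta>
    by (simp add: taylor_term_def q_def pcompose_coeff_0)
  \<comment> \<open>Index \<open>0\<close> is left out because its term does not vary with the
    radius; terms with vanishing coefficient never reach \<tau>.\<close>
  define S where "S = {i. 0 < i \<and> i \<le> degree q \<and> coeff q i \<noteq> 0}"
  have fin: "finite S"
    by (rule finite_subset[of _ "{..degree q}"]) (auto simp: S_def)
  obtain i where i: "i \<le> degree q" "ball_val c \<gamma> p = ?T \<gamma> i"
    using gauss_attained[of q \<gamma>] unfolding ball_val_def q_def by blast
  \<comment> \<open>The constant term is at least \<tau>, so a smaller minimum comes from another
    term; hence \<open>S\<close> is nonempty.\<close>
  have "i \<noteq> 0"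
    using i assms q0[of \<gamma>] by (metis not_le)
  moreover have "coeff q i \<noteq> 0"
    using i(2) assms(1) taylor_term_eq_Top[of \<gamma> q i] by auto
  ultimately have "i \<in> S"
    using i by (simp add: S_def)
  have "\<exists>t. ?T t i = top.Value \<tau>" if "i \<in> S" for i
  proof -
    have "v' (coeff q i) \<noteq> top.Top"
      using that by (simp add: S_def v.eq_Top_iff)
    then obtain x where x: "v' (coeff q i) = top.Value x"
      by (cases "v' (coeff q i)") auto
    have "i > 0"
      using that by (simp add: S_def)
    then obtain t where "ntimes i t = \<tau> - x"
      using divisible[of i "\<tau> - x"] by (auto simp: ntimes_def)
    then show ?thesis
      by (intro exI[of _ t]) (simp add: taylor_term_def x ntimes_Value)
  qed
  then obtain t where t: "?T (t i) i = top.Value \<tau>" if "i \<in> S" for i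
    by metis
  define \<delta> where "\<delta> = Max (t ` S)"
  have "\<delta> \<in> t ` S"
    unfolding \<delta>_def using fin \<open>i \<in> S\<close> by (intro Max_in) auto
  then obtain m where m: "m \<in> S" "\<delta> = t m"
    by auto
  have Tm: "?T \<delta> m = top.Value \<tau>"
    using t m by simp
  have "top.Value \<tau> \<le> ?T \<delta> i" for i
  proof (cases "i \<in> S")
    case True
    then have "t i \<le> \<delta>"
      unfolding \<delta>_def using fin by simp
    then have "?T (t i) i \<le> ?T \<delta> i"
      by (simp add: taylor_term_def add_left_mono ntimes_mono)
    then show ?thesis
      using t[OF True] by simp
  next
    case False
    then show ?thesis
      using assms(2) q0[of \<delta>] taylor_term_eq_Top[of \<delta> q i] coeff_eq_0[of q i]
      by (cases "i = 0"; cases "i \<le> degree q") (auto simp: S_def)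
  qed
  then have "top.Value \<tau> \<le> ball_val c \<delta> p"
    unfolding ball_val_def q_def[symmetric] by (rule gauss_ge)
  then have val: "ball_val c \<delta> p = top.Value \<tau>"
    using gauss_le[of \<delta> q m] Tm by (simp add: ball_val_def q_def)
  moreover have "\<gamma> < \<delta>"
    using ball_val_mono[of \<delta> \<gamma> c p] assms(1) val by (metis not_le)
  moreover have "\<not> ball_unit c \<delta> p"
  proof
    assume unit: "ball_unit c \<delta> p"
    have "p \<noteq> 0"
      using val by auto
    then have "v' (poly p c) < ?T \<delta> m"
      using unit m by (simp add: ball_unit_iff q_def S_def)
    then show False
      using Tm assms(2) by simp
  qed
  \<comment> \<open>At any smaller radius the term of index \<open>m\<close> lies below
    \<tau>.\<close>
  moreover have "\<delta> \<le> \<delta>'" if "top.Value \<tau> \<le> ball_val c \<delta>' p" for \<delta>'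
  proof (rule ccontr)
    assume "\<not> \<delta> \<le> \<delta>'"
    then have "ntimes m (top.Value \<delta>') < ntimes m (top.Value \<delta>)"
      using m by (simp add: ntimes_Value ntimes_strict_mono S_def)
    moreover have "v' (coeff q m) \<noteq> top.Top"
      using m by (simp add: S_def v.eq_Top_iff)
    ultimately have "?T \<delta>' m < ?T \<delta> m"
      by (simp add: taylor_term_def top_add_less_cancel_left)
    also have "\<dots> \<le> ball_val c \<delta>' p"
      using that Tm by simp
    also have "\<dots> \<le> ?T \<delta>' m"
      using gauss_le[of \<delta>' q m] by (simp add: ball_val_def q_def)
    finally show False
      by simp
  qed
  ultimately show thesis
    using that by blast
qed

end

subsection \<open>Transcendental elements\<close>

lemma const_fract_hom:
  "const_fract (a * b) = const_fract a * const_fract b"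
  "const_fract 1 = 1" "const_fract 0 = 0" "const_fract a = 0 \<longleftrightarrow> a = 0"
  by (simp_all add: const_fract_def flip: to_fract_mult to_fract_1 one_pCons)

context
  fixes \<mu> :: "'f::field \<Rightarrow> 'g::linordered_ab_group_add top"
  assumes \<mu>: "valuation \<mu>"
begin

interpretation \<mu>: ring_valuation \<mu>
  using \<mu> by (simp add: valuation_iff_ring_valuation)

lemma valuation_inverse:
  assumes "\<mu> a = top.Value x"
  shows "\<mu> (inverse a) = top.Value (- x)"
proof -
  have "a \<noteq> 0"
    using assms by auto
  then have "\<mu> a + \<mu> (inverse a) = 0"
    by (simp flip: \<mu>.mult)
  then show ?thesis
    using assms by (cases "\<mu> (inverse a)") (auto simp: zero_top_def add_eq_0_iff)
qed

lemma comm_group_value_group: "comm_group (value_group \<mu>)"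
proof (rule comm_groupI)
  have "\<exists>c. \<mu> c = top.Value (x + y)" if "\<mu> a = top.Value x" "\<mu> b = top.Value y" for a b x y
    using that \<mu>.mult[of a b] by (intro exI[of _ "a * b"]) simp
  then show "x \<otimes>\<^bsub>value_group \<mu>\<^esub> y \<in> carrier (value_group \<mu>)"
    if "x \<in> carrier (value_group \<mu>)" "y \<in> carrier (value_group \<mu>)" for x y
    using that by (auto simp: value_group_def)
  show "\<one>\<^bsub>value_group \<mu>\<^esub> \<in> carrier (value_group \<mu>)"
    using \<mu>.one by (auto simp: value_group_def zero_top_def simp del: \<mu>.one)
  show "\<exists>y\<in>carrier (value_group \<mu>). y \<otimes>\<^bsub>value_group \<mu>\<^esub> x = \<one>\<^bsub>value_group \<mu>\<^esub>"
    if "x \<in> carrier (value_group \<mu>)" for x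
    using that valuation_inverse by (fastforce simp: value_group_def)
qed (auto simp: value_group_def add_ac)

lemma ring_valuation_ring: "ring (valuation_ring \<mu>)"
proof -
  have pos: "top.Value 0 \<le> \<mu> (a + b)" "top.Value 0 \<le> \<mu> (a * b)"
    if "top.Value 0 \<le> \<mu> a" "top.Value 0 \<le> \<mu> b" for a b
    using that \<mu>.add_ge[of a b] add_nonneg_nonneg[of "\<mu> a" "\<mu> b"]
    by (auto simp: \<mu>.mult zero_top_def min_def split: if_splits intro: order.trans)
  have "\<exists>y. top.Value 0 \<le> \<mu> y \<and> x + y = 0" if "top.Value 0 \<le> \<mu> x" for x
    using that by (intro exI[of _ "- x"]) simp
  moreover have "top.Value 0 \<le> \<mu> 1"
    by (simp add: zero_top_def)
  ultimately show ?thesis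
    using pos unfolding valuation_ring_def ring_of_type_algebra_def
    by unfold_locales (auto simp: algebra_simps Units_def)
qed

lemma ideal_valuation_ideal: "ideal (valuation_ideal \<mu>) (valuation_ring \<mu>)"
proof (rule idealI)
  show "ring (valuation_ring \<mu>)"
    by (rule ring_valuation_ring)
  interpret O: ring "valuation_ring \<mu>"
    by (rule ring_valuation_ring)
  have inv: "inv\<^bsub>add_monoid (valuation_ring \<mu>)\<^esub> x = - x" if "top.Value 0 \<le> \<mu> x" for x
    using that by (intro O.add.inv_equality[unfolded a_inv_def]) (auto simp: valuation_ring_def ring_of_type_algebra_def)
  have add: "top.Value 0 < \<mu> (a + b)" if "top.Value 0 < \<mu> a" "top.Value 0 < \<mu> b" for a b
    using that \<mu>.add_ge[of a b] by (auto simp: min_def split: if_splits intro: less_le_trans)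
  show "subgroup (valuation_ideal \<mu>) (add_monoid (valuation_ring \<mu>))"
  proof (rule subgroup.intro)
    fix x
    assume x: "x \<in> valuation_ideal \<mu>"
    then have "inv\<^bsub>add_monoid (valuation_ring \<mu>)\<^esub> x = - x"
      by (intro inv) (simp add: valuation_ideal_def)
    moreover have "- x \<in> valuation_ideal \<mu>"
      using x by (simp add: valuation_ideal_def)
    ultimately show "inv\<^bsub>add_monoid (valuation_ring \<mu>)\<^esub> x \<in> valuation_ideal \<mu>"
      by (simp only:)
  qed (auto simp: add less_imp_le valuation_ideal_def valuation_ring_def ring_of_type_algebra_def)
  have mult: "top.Value 0 < \<mu> (a * b)" if "top.Value 0 < \<mu> a" "top.Value 0 \<le> \<mu> b" for a b
    using top_add_less_le_mono[OF that] by (simp add: \<mu>.mult)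
  show "x \<otimes>\<^bsub>valuation_ring \<mu>\<^esub> a \<in> valuation_ideal \<mu>" "a \<otimes>\<^bsub>valuation_ring \<mu>\<^esub> x \<in> valuation_ideal \<mu>"
    if "a \<in> valuation_ideal \<mu>" "x \<in> carrier (valuation_ring \<mu>)" for a x
    using that mult[of a x] by (simp_all add: mult.commute valuation_ideal_def valuation_ring_def ring_of_type_algebra_def)
qed

text \<open>\<alpha> represents \<xi>. An integral polynomial with leading coefficient of value zero
  and positive value at \<alpha> would reduce to a nonzero polynomial over the residue subfield
  vanishing at \<xi>.\<close>

lemma transcendental_residue:
  fixes \<phi> :: "'e::field \<Rightarrow> 'f" and v :: "'e \<Rightarrow> 'g top"
  assumes \<phi>: "\<And>a. \<mu> (\<phi> a) = v a"
    and \<xi>: "\<xi> \<in> carrier (residue_field \<mu>)" "ring.transcendental (residue_field \<mu>) (residue_subfield \<phi> v \<mu>) \<xi>"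
  shows "\<exists>\<alpha>. 0 \<le> \<mu> \<alpha> \<and> (\<forall>n c. (\<forall>i\<le>n. 0 \<le> v (c i)) \<longrightarrow> v (c n) = 0 \<longrightarrow> \<mu> (\<Sum>i\<le>n. \<phi> (c i) * \<alpha> ^ i) \<le> 0)"
proof -
  let ?O = "valuation_ring \<mu>" and ?I = "valuation_ideal \<mu>" and ?Q = "residue_field \<mu>" and ?\<pi> = "residue_class \<mu>"
  interpret I: ideal ?I ?O
    by (rule ideal_valuation_ideal)
  interpret Q: ring ?Q
    unfolding residue_field_def by (rule I.quotient_is_ring)
  interpret \<pi>: ring_hom_ring ?O ?Q ?\<pi>
    using I.rcos_ring_hom_ring unfolding residue_field_def residue_class_def[abs_def] .
  have carrier: "a \<in> carrier ?O \<longleftrightarrow> 0 \<le> \<mu> a" for a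
    by (simp add: valuation_ring_def zero_top_def)
  have O_simps: "a \<otimes>\<^bsub>?O\<^esub> b = a * b" "a \<oplus>\<^bsub>?O\<^esub> b = a + b" "\<zero>\<^bsub>?O\<^esub> = 0" "\<one>\<^bsub>?O\<^esub> = 1" for a b
    by (simp_all add: valuation_ring_def ring_of_type_algebra_def)
  have pow: "a [^]\<^bsub>?O\<^esub> (n :: nat) = a ^ n" for a n
    by (induction n) (simp_all add: O_simps mult.commute)
  have zero: "?\<pi> a = \<zero>\<^bsub>?Q\<^esub> \<longleftrightarrow> 0 < \<mu> a" if "a \<in> carrier ?O" for a
  proof -
    have "?\<pi> a = ?I \<longleftrightarrow> a \<in> ?I"
      unfolding residue_class_def using that I.a_rcos_const I.a_rcos_self by metis
    then show ?thesis
      by (simp add: residue_field_def FactRing_def valuation_ideal_def zero_top_def)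
  qed
  obtain \<alpha> where \<alpha>: "\<alpha> \<in> carrier ?O" "\<xi> = ?\<pi> \<alpha>"
    using \<xi>(1) by (auto simp: residue_field_def FactRing_def A_RCOSETS_def' residue_class_def)
  \<comment> \<open>Polynomials over the residue field are lists headed by the leading coefficient,
    hence \<open>rev\<close>.\<close>
  define l where "l c n = map (\<lambda>k. ?\<pi> (\<phi> (c k))) (rev [0..<Suc n])" for c :: "nat \<Rightarrow> 'e" and n
  have l_Suc: "l c (Suc n) = ?\<pi> (\<phi> (c (Suc n))) # l c n" for c n
    by (simp add: l_def)
  have l_0: "l c 0 = [?\<pi> (\<phi> (c 0))]" for c
    by (simp add: l_def)
  have sum_carrier: "(\<Sum>i\<le>n. \<phi> (c i) * \<alpha> ^ i) \<in> carrier ?O" if "\<forall>i\<le>n. 0 \<le> v (c i)" for c n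
  proof -
    have "0 \<le> \<mu> (\<Sum>i\<le>n. \<phi> (c i) * \<alpha> ^ i) + 0"
    proof (rule \<mu>.sum_ge)
      fix i
      assume "i \<in> {..n}"
      moreover have "0 \<le> ntimes i (\<mu> \<alpha>)"
        using ntimes_mono[of 0 "\<mu> \<alpha>" i] \<alpha> by (simp add: carrier ntimes_def)
      ultimately show "0 \<le> \<mu> (\<phi> (c i) * \<alpha> ^ i) + 0"
        using that by (simp add: \<mu>.mult \<mu>.power \<phi>)
    qed
    then show ?thesis
      by (simp add: carrier)
  qed
  have eval: "Q.eval (l c n) \<xi> = ?\<pi> (\<Sum>i\<le>n. \<phi> (c i) * \<alpha> ^ i)" if "\<forall>i\<le>n. 0 \<le> v (c i)" for c n
    using that
  proof (induction n)
    case 0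
    then have "\<phi> (c 0) \<in> carrier ?O"
      by (simp add: carrier \<phi>)
    then show ?case
      using \<alpha> by (simp add: l_0)
  next
    case (Suc n)
    then have c: "\<phi> (c (Suc n)) \<in> carrier ?O"
      by (simp add: carrier \<phi>)
    have a: "\<alpha> ^ Suc n \<in> carrier ?O"
      using \<alpha>(1) I.nat_pow_closed pow by metis
    have ca: "\<phi> (c (Suc n)) * \<alpha> ^ Suc n \<in> carrier ?O"
      using c a I.m_closed O_simps by metis
    have "Q.eval (l c (Suc n)) \<xi> = (?\<pi> (\<phi> (c (Suc n))) \<otimes>\<^bsub>?Q\<^esub> \<xi> [^]\<^bsub>?Q\<^esub> Suc n) \<oplus>\<^bsub>?Q\<^esub> Q.eval (l c n) \<xi>"
      by (simp only: l_Suc Q.eval.simps list.sel list.size) (simp add: l_def)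
    also have "\<xi> [^]\<^bsub>?Q\<^esub> Suc n = ?\<pi> (\<alpha> ^ Suc n)"
      unfolding \<alpha>(2) using \<pi>.hom_nat_pow[OF \<alpha>(1), of "Suc n"] by (simp only: pow)
    also have "?\<pi> (\<phi> (c (Suc n))) \<otimes>\<^bsub>?Q\<^esub> ?\<pi> (\<alpha> ^ Suc n) = ?\<pi> (\<phi> (c (Suc n)) * \<alpha> ^ Suc n)"
      using \<pi>.hom_mult[OF c a] by (simp add: O_simps)
    also have "Q.eval (l c n) \<xi> = ?\<pi> (\<Sum>i\<le>n. \<phi> (c i) * \<alpha> ^ i)"
      using Suc by simp
    also have "?\<pi> (\<phi> (c (Suc n)) * \<alpha> ^ Suc n) \<oplus>\<^bsub>?Q\<^esub> \<dots> = ?\<pi> (\<Sum>i\<le>Suc n. \<phi> (c i) * \<alpha> ^ i)"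
      using \<pi>.hom_add[OF ca sum_carrier[of n c]] Suc.prems by (simp add: O_simps add.commute)
    finally show ?case .
  qed
  have "\<mu> (\<Sum>i\<le>n. \<phi> (c i) * \<alpha> ^ i) \<le> 0" if c: "\<forall>i\<le>n. 0 \<le> v (c i)" "v (c n) = 0" for c n
  proof (rule ccontr)
    assume "\<not> ?thesis"
    then have "Q.eval (l c n) \<xi> = Q.eval [] \<xi>"
      using zero[OF sum_carrier[OF c(1)]] eval[OF c(1)] by simp
    \<comment> \<open>The head of the list must be nonzero, which is where
      \<open>v (c n) = 0\<close> enters.\<close>
    moreover have "l c n \<in> carrier (residue_subfield \<phi> v \<mu> [X]\<^bsub>?Q\<^esub>)"
    proof -
      have "hd (l c n) = ?\<pi> (\<phi> (c n))"
        by (simp add: l_def)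
      moreover have "?\<pi> (\<phi> (c n)) \<noteq> \<zero>\<^bsub>?Q\<^esub>"
        using c zero[of "\<phi> (c n)"] by (simp add: carrier \<phi>)
      moreover have "set (l c n) \<subseteq> residue_subfield \<phi> v \<mu>"
        using c by (auto simp: l_def residue_subfield_def valuation_ring_def zero_top_def)
      ultimately show ?thesis
        by (simp add: univ_poly_def polynomial_def)
    qed
    moreover have "[] \<in> carrier (residue_subfield \<phi> v \<mu> [X]\<^bsub>?Q\<^esub>)"
      by (simp add: univ_poly_def polynomial_def)
    \<comment> \<open>Evaluation at \<xi> is injective, and \<open>[]\<close> represents the zero
      polynomial.\<close>
    ultimately have "l c n = []"
      using \<xi>(2) unfolding Q.transcendental_def by (metis inj_onD)
    then show False
      by (simp add: l_def)
  qed
  then show ?thesis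
    using \<alpha> carrier by blast
qed

end

lemma least_value_atMost: "\<exists>j\<le>n. \<forall>i\<le>n. f j \<le> (f i :: 'a::linorder)" for n :: nat
proof -
  have "Min (f ` {..n}) \<in> f ` {..n}"
    by (rule Min_in) auto
  then obtain j where "Min (f ` {..n}) = f j" "j \<le> n"
    by (elim imageE) simp
  then show ?thesis
    by (intro exI[of _ j]) (auto simp flip: \<open>Min (f ` {..n}) = f j\<close>)
qed

text \<open>Both kinds of transcendence give the same property: a polynomial expression in \<alpha>
  has the minimum of the values of its terms. In the nontorsion case nonzero terms have distinct
  values; in the residue case \<open>\<mu> \<alpha> = 0\<close>, and scaling makes some coefficient
  a unit.\<close>

lemma valuation_transcendental_element:
  fixes v :: "'k::field \<Rightarrow> 'g::linordered_ab_group_add top"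
  assumes v: "valuation v" and \<mu>: "\<mu> \<in> valuation_extensions const_fract v" "valuation_transcendental v \<mu>"
  obtains \<alpha> where "\<alpha> \<noteq> 0"
    "\<And>n c k. k \<le> n \<Longrightarrow> \<mu> (\<Sum>i\<le>n. const_fract (c i) * \<alpha> ^ i) \<le> \<mu> (const_fract (c k) * \<alpha> ^ k)"
proof -
  have val: "valuation \<mu>" and ext: "\<mu> (const_fract a) = v a" for a
    using \<mu>(1) by (auto simp: valuation_extensions_def)
  interpret v: ring_valuation v
    using v by (simp add: valuation_iff_ring_valuation)
  interpret \<mu>: ring_valuation \<mu>
    using val by (simp add: valuation_iff_ring_valuation)
  show thesis
  proof (cases "torsion_group (value_group \<mu> Mod carrier (value_group v))")
    case False
    let ?G = "value_group \<mu>" and ?H = "carrier (value_group v)"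
    interpret G: comm_group ?G
      using val by (rule comm_group_value_group)
    have sub: "?H \<subseteq> carrier ?G"
      by (auto simp: value_group_def simp flip: ext)
    have "subgroup ?H ?G"
    proof (rule G.subgroupI)
      show "?H \<subseteq> carrier ?G"
        by fact
      interpret H: comm_group "value_group v"
        using v by (rule comm_group_value_group)
      show "?H \<noteq> {}"
        using H.one_closed by auto
      show "a \<otimes>\<^bsub>?G\<^esub> b \<in> ?H" if "a \<in> ?H" "b \<in> ?H" for a b
        using H.m_closed[OF that] by (simp add: value_group_def)
      show "inv\<^bsub>?G\<^esub> a \<in> ?H" if "a \<in> ?H" for a
      proof -
        have "inv\<^bsub>value_group v\<^esub> a \<otimes>\<^bsub>?G\<^esub> a = \<one>\<^bsub>?G\<^esub>"
          using H.l_inv[OF that] by (simp add: value_group_def)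
        then have "inv\<^bsub>?G\<^esub> a = inv\<^bsub>value_group v\<^esub> a"
          using that sub H.inv_closed[OF that] by (intro G.inv_equality) auto
        then show ?thesis
          using H.inv_closed[OF that] by simp
      qed
    qed
    then interpret N: normal ?H ?G
      by (rule G.subgroup_imp_normal)
    \<comment> \<open>A coset of infinite order: no positive multiple of its representative \<gamma>
      lies in the value group of \<open>v\<close>.\<close>
    obtain B where B: "B \<in> carrier (?G Mod ?H)" "\<And>n::nat. n > 0 \<Longrightarrow> B [^]\<^bsub>?G Mod ?H\<^esub> n \<noteq> \<one>\<^bsub>?G Mod ?H\<^esub>"
      using False unfolding torsion_group_def by blast
    then obtain \<gamma> where \<gamma>: "\<gamma> \<in> carrier ?G" "B = ?H #>\<^bsub>?G\<^esub> \<gamma>"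
      by (auto simp: carrier_FactGroup)
    have pow: "\<gamma> [^]\<^bsub>?G\<^esub> (n :: nat) = ntimes n \<gamma>" for n
      by (induction n) (simp_all add: value_group_def nat_pow_def)
    have nontorsion: "v a \<noteq> top.Value (ntimes n \<gamma>)" if "n > 0" for a n
    proof
      assume "v a = top.Value (ntimes n \<gamma>)"
      then have "ntimes n \<gamma> \<in> ?H"
        by (auto simp: value_group_def)
      then have "?H #>\<^bsub>?G\<^esub> ntimes n \<gamma> = ?H"
        by (intro G.coset_join2) (use sub N.subgroup_axioms in auto)
      then show False
        using B(2)[OF that] N.FactGroup_pow[OF \<gamma>(1), of n] \<gamma>(2) pow by simp
    qed
    obtain \<alpha> where \<alpha>: "\<mu> \<alpha> = top.Value \<gamma>"
      using \<gamma>(1) by (auto simp: value_group_def)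
    have val_monom: "\<mu> (const_fract a * \<alpha> ^ i) = v a + top.Value (ntimes i \<gamma>)" for a i
      by (simp add: \<mu>.mult \<mu>.power ext \<alpha> ntimes_Value)
    \<comment> \<open>Equality would make \<open>(j - i)\<gamma>\<close> the value of
      \<open>a / b\<close>.\<close>
    have distinct_less: "\<mu> (const_fract a * \<alpha> ^ i) \<noteq> \<mu> (const_fract b * \<alpha> ^ j)" if "i < j" "b \<noteq> 0" for a b i j
    proof
      assume eq: "\<mu> (const_fract a * \<alpha> ^ i) = \<mu> (const_fract b * \<alpha> ^ j)"
      have "v b \<noteq> top.Top"
        using that by (simp add: v.eq_Top_iff)
      then obtain y where y: "v b = top.Value y"
        by (cases "v b") auto
      have "ntimes j \<gamma> = ntimes i \<gamma> + ntimes (j - i) \<gamma>"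
        using that ntimes_add[of i "j - i" \<gamma>] by simp
      then have "v a = top.Value (y + ntimes (j - i) \<gamma>)"
        using eq y by (cases "v a") (simp_all add: val_monom algebra_simps)
      then have "v (a * inverse b) = top.Value (ntimes (j - i) \<gamma>)"
        using valuation_inverse[OF v y] by (simp add: v.mult)
      then show False
        using nontorsion that by simp
    qed
    show thesis
    proof (rule that[of \<alpha>])
      show "\<alpha> \<noteq> 0"
        using \<alpha> by auto
      fix n c and k :: nat
      assume "k \<le> n"
      let ?t = "\<lambda>i. \<mu> (const_fract (c i) * \<alpha> ^ i)"
      obtain j where j: "j \<le> n" "\<And>i. i \<le> n \<Longrightarrow> ?t j \<le> ?t i"
        using least_value_atMost[of n ?t] by blast
      show "\<mu> (\<Sum>i\<le>n. const_fract (c i) * \<alpha> ^ i) \<le> ?t k"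
      proof (cases "c j = 0")
        case True
        then have "?t k = top.Top"
          using j(2)[OF \<open>k \<le> n\<close>] by (simp add: const_fract_hom)
        then show ?thesis
          by simp
      next
        case False
        then have fin: "?t j \<noteq> top.Top"
          by (simp add: val_monom v.eq_Top_iff)
        have "?t j < ?t i" if "i \<le> n" "i \<noteq> j" for i
        proof -
          have "?t j \<noteq> ?t i"
          proof (cases "i < j")
            case True
            then show ?thesis
              using distinct_less[of i j "c j" "c i"] \<open>c j \<noteq> 0\<close> by metis
          next
            case False
            then show ?thesis
              using distinct_less[of j i "c i" "c j"] that fin
              by (cases "c i = 0") (auto simp: const_fract_hom)
          qed
          then show ?thesis
            using j(2)[OF \<open>i \<le> n\<close>] by simp
        qed
        then have "?t j < \<mu> (\<Sum>i\<in>{..n} - {j}. const_fract (c i) * \<alpha> ^ i) + 0"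
          by (intro \<mu>.sum_greater fin) auto
        then have "\<mu> (const_fract (c j) * \<alpha> ^ j + (\<Sum>i\<in>{..n} - {j}. const_fract (c i) * \<alpha> ^ i)) = ?t j"
          by (intro \<mu>.add_eq_left) simp
        then have "\<mu> (\<Sum>i\<le>n. const_fract (c i) * \<alpha> ^ i) = ?t j"
          using j(1) by (subst sum.remove[of _ j]) auto
        then show ?thesis
          using j(2)[OF \<open>k \<le> n\<close>] by simp
      qed
    qed
  next
    case True
    then obtain \<alpha> where \<alpha>: "0 \<le> \<mu> \<alpha>"
      "\<And>n c. \<forall>i\<le>n. 0 \<le> v (c i) \<Longrightarrow> v (c n) = 0 \<Longrightarrow> \<mu> (\<Sum>i\<le>n. const_fract (c i) * \<alpha> ^ i) \<le> 0"
      using \<mu>(2) transcendental_residue[OF val, of const_fract v] ext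
      unfolding valuation_transcendental_def by blast
    \<comment> \<open>The linear polynomial with coefficients \<open>0\<close> and \<open>1\<close>
      bounds \<alpha> itself.\<close>
    have "\<mu> \<alpha> \<le> 0"
      using \<alpha>(2)[of 1 "\<lambda>i. if i = 0 then 0 else 1"] by (simp add: const_fract_hom)
    then have \<mu>_\<alpha>: "\<mu> \<alpha> = 0"
      using \<alpha>(1) by simp
    have ntimes_0: "ntimes i (0 :: 'g top) = 0" for i
      by (simp add: ntimes_def)
    have val_monom: "\<mu> (const_fract a * \<alpha> ^ i) = v a" for a i
      by (simp add: \<mu>.mult \<mu>.power ext \<mu>_\<alpha> ntimes_0)
    \<comment> \<open>The unit coefficient may now have any index: leading terms of positive value
      are dropped one by one.\<close>
    have unit: "\<mu> (\<Sum>i\<le>n. const_fract (d i) * \<alpha> ^ i) \<le> 0"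
      if "\<forall>i\<le>n. 0 \<le> v (d i)" "j \<le> n" "v (d j) = 0" for n j d
      using that
    proof (induction n)
      case (Suc n)
      show ?case
      proof (cases "v (d (Suc n)) = 0")
        case True
        then show ?thesis
          using Suc by (intro \<alpha>(2)) auto
      next
        case False
        then have "j \<noteq> Suc n"
          using Suc by auto
        then have IH: "\<mu> (\<Sum>i\<le>n. const_fract (d i) * \<alpha> ^ i) \<le> 0"
          using Suc by auto
        also have "0 < \<mu> (const_fract (d (Suc n)) * \<alpha> ^ Suc n)"
          using False Suc.prems(1) by (auto simp only: val_monom less_le)
        finally show ?thesis
          using IH by (simp add: \<mu>.add_eq_left del: power_Suc)
      qed
    qed (simp add: ext)
    show thesis
    proof (rule that[of \<alpha>])
      show "\<alpha> \<noteq> 0"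
        using \<mu>_\<alpha> by auto
      fix n c and k :: nat
      assume "k \<le> n"
      obtain j where j: "j \<le> n" "\<And>i. i \<le> n \<Longrightarrow> v (c j) \<le> v (c i)"
        using least_value_atMost[of n "\<lambda>i. v (c i)"] by blast
      show "\<mu> (\<Sum>i\<le>n. const_fract (c i) * \<alpha> ^ i) \<le> \<mu> (const_fract (c k) * \<alpha> ^ k)"
      proof (cases "v (c j)")
        case Top
        then show ?thesis
          using j(2)[OF \<open>k \<le> n\<close>] by (simp add: val_monom)
      next
        case (Value y)
        then have cj: "c j \<noteq> 0"
          by auto
        \<comment> \<open>Dividing by a coefficient of least value makes all coefficients integral
          and one a unit.\<close>
        define d where "d i = c i * inverse (c j)" for i
        have vd: "v (d i) = v (c i) + top.Value (- y)" for i
          using valuation_inverse[OF v Value] by (simp add: d_def v.mult)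
        have "0 \<le> v (d i)" if "i \<le> n" for i
          using add_right_mono[OF j(2)[OF that], of "top.Value (- y)"] Value by (simp add: vd zero_top_def)
        moreover have "v (d j) = 0"
          by (simp add: vd Value zero_top_def)
        ultimately have S: "\<mu> (\<Sum>i\<le>n. const_fract (d i) * \<alpha> ^ i) \<le> 0"
          using j(1) by (intro unit[of n _ j]) auto
        have c_eq: "c i = c j * d i" for i
          using cj by (simp add: d_def)
        have "(\<Sum>i\<le>n. const_fract (c i) * \<alpha> ^ i) = const_fract (c j) * (\<Sum>i\<le>n. const_fract (d i) * \<alpha> ^ i)"
          unfolding sum_distrib_left by (intro sum.cong refl, subst c_eq) (simp add: const_fract_hom mult_ac)
        then have "\<mu> (\<Sum>i\<le>n. const_fract (c i) * \<alpha> ^ i) \<le> v (c j) + 0"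
          using S by (simp only: \<mu>.mult ext add_left_mono)
        also have "\<dots> \<le> v (c k)"
          using j(2)[OF \<open>k \<le> n\<close>] by simp
        finally show ?thesis
          by (simp add: val_monom)
      qed
    qed
  qed
qed

section \<open>Enlarging a chain of concentric balls\<close>

context valued_closure
begin

text \<open>In the induction on \<open>degree f < degree h\<close>, division \<open>h = q * f + r\<close> forces \<open>q * f\<close> and \<open>r\<close> to cancel to
  leading order, so that \<open>f\<close> inherits from \<open>r\<close> the absence of roots in the new ball.\<close>

lemma ball_val_augment:
  assumes \<nu>: "ring_valuation \<nu>" "\<And>a. \<nu> [:a:] = v a"
    and \<Gamma>: "\<Gamma> \<noteq> {}"
    and good: "\<And>\<gamma> p. \<gamma> \<in> \<Gamma> \<Longrightarrow> ball_val c \<gamma> (lift p) \<le> \<nu> p"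
    and less: "\<And>\<gamma>. \<gamma> \<in> \<Gamma> \<Longrightarrow> ball_val c \<gamma> (lift h) < \<nu> h"
    and min: "\<And>f. degree f < degree h \<Longrightarrow> \<exists>\<gamma>\<in>\<Gamma>. ball_val c \<gamma> (lift f) = \<nu> f"
    and hc: "\<nu> h \<le> v' (poly (lift h) c)"
  shows "\<exists>\<delta>. (\<forall>\<gamma>\<in>\<Gamma>. \<gamma> < \<delta>) \<and> (\<forall>p. ball_val c \<delta> (lift p) \<le> \<nu> p) \<and>
    (\<forall>\<delta>'. \<nu> h \<le> ball_val c \<delta>' (lift h) \<longrightarrow> \<delta> \<le> \<delta>')"
proof -
  interpret \<nu>: ring_valuation \<nu> by fact
  obtain \<gamma>\<^sub>0 where \<gamma>\<^sub>0: "\<gamma>\<^sub>0 \<in> \<Gamma>"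
    using \<Gamma> by auto
  have "h \<noteq> 0"
    using less[OF \<gamma>\<^sub>0] by auto
  then obtain \<tau> where \<tau>: "\<nu> h = top.Value \<tau>"
    using \<nu>.eq_Top_iff[of h] by (cases "\<nu> h") auto
  \<comment> \<open>The least radius at \<open>c\<close> for which \<open>lift h\<close> attains
    \<open>\<nu> h\<close>.\<close>
  obtain \<delta> where \<delta>: "\<gamma>\<^sub>0 < \<delta>" "ball_val c \<delta> (lift h) = \<nu> h" "\<not> ball_unit c \<delta> (lift h)"
    "\<And>\<delta>'. \<nu> h \<le> ball_val c \<delta>' (lift h) \<Longrightarrow> \<delta> \<le> \<delta>'"
    using ball_val_intermediate[of c \<gamma>\<^sub>0 "lift h" \<tau>] less[OF \<gamma>\<^sub>0] hc unfolding \<tau> by blast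
  have above: "\<gamma> < \<delta>" if "\<gamma> \<in> \<Gamma>" for \<gamma>
    using less[OF that] ball_val_mono[of \<delta> \<gamma> c "lift h"] \<delta>(2) by (metis not_le)
  have "degree h > 0"
  proof (rule ccontr)
    assume "\<not> ?thesis"
    then obtain a where "h = [:a:]"
      using degree_eq_zeroE by blast
    then show False
      using less[OF \<gamma>\<^sub>0] \<nu>(2) by (simp add: v'_\<iota>)
  qed
  \<comment> \<open>At larger radii in \<Gamma> the value stays between the one already attained and
    that of \<nu>.\<close>
  have agree_mono: "ball_val c \<gamma>' (lift f) = \<nu> f"
    if "ball_val c \<gamma> (lift f) = \<nu> f" "\<gamma> \<le> \<gamma>'" "\<gamma>' \<in> \<Gamma>" for f \<gamma> \<gamma>'
    using ball_val_mono[OF that(2)] good[OF that(3)] that(1) by (metis order.antisym)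
  have unit: "ball_val c \<delta> (lift f) = \<nu> f \<and> ball_unit c \<delta> (lift f)" if "f \<noteq> 0" "degree f < degree h" for f
    using that
  proof (induction "degree f" arbitrary: f rule: less_induct)
    case less: less
    show ?case
    proof (cases "degree f = 0")
      case True
      then obtain a where "f = [:a:]"
        using degree_eq_zeroE by blast
      then show ?thesis
        using less \<nu>(2) by (simp add: v'_\<iota>)
    next
      case False
      define q r where "q = h div f" and "r = h mod f"
      have h: "h = q * f + r"
        by (simp add: q_def r_def)
      have r: "r = 0 \<or> degree r < degree f"
        unfolding r_def using degree_mod_less[OF \<open>f \<noteq> 0\<close>] .
      have "q \<noteq> 0"
        using h r less.prems False by auto
      then have deg_qf: "degree (q * f) = degree q + degree f"
        using less.prems by (simp add: degree_mult_eq)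
      have "degree h = degree (q * f)"
        unfolding h using r deg_qf degree_add_eq_left[of r "q * f"] by (cases "r = 0") auto
      then have "degree q < degree h"
        using deg_qf False by simp
      moreover have "degree r < degree h"
        using r less.prems by auto
      ultimately obtain \<gamma>1 \<gamma>2 \<gamma>3 where \<gamma>s: "\<gamma>1 \<in> \<Gamma>" "ball_val c \<gamma>1 (lift q) = \<nu> q"
        "\<gamma>2 \<in> \<Gamma>" "ball_val c \<gamma>2 (lift f) = \<nu> f" "\<gamma>3 \<in> \<Gamma>" "ball_val c \<gamma>3 (lift r) = \<nu> r"
        using min[of q] min[of f] min[of r] less.prems by blast
      \<comment> \<open>A single radius at which \<open>q\<close>, \<open>f\<close> and
        \<open>r\<close> all agree with \<nu>.\<close>
      define \<gamma> where "\<gamma> = max \<gamma>1 (max \<gamma>2 \<gamma>3)"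
      have \<gamma>: "\<gamma> \<in> \<Gamma>" "\<gamma>1 \<le> \<gamma>" "\<gamma>2 \<le> \<gamma>" "\<gamma>3 \<le> \<gamma>"
        using \<gamma>s by (auto simp: \<gamma>_def max_def)
      let ?w = "ball_val c \<gamma>" and ?w' = "ball_val c \<delta>"
      have w: "?w (lift q) = \<nu> q" "?w (lift f) = \<nu> f" "?w (lift r) = \<nu> r"
        using \<gamma>s \<gamma> agree_mono by blast+
      then have wqf: "?w (lift (q * f)) = \<nu> (q * f)"
        by (simp add: lift_mult ball.mult \<nu>.mult)
      have wh: "?w (lift h) < \<nu> h"
        using \<gamma>(1) by (rule assms(5))
      have "r \<noteq> 0"
        using wqf wh h by auto
      then have IH: "?w' (lift r) = \<nu> r" "ball_unit c \<delta> (lift r)"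
        using less.hyps[of r] r less.prems by auto
      \<comment> \<open>With distinct values nothing cancels, and \<open>h\<close> would already
        have its full value at \<gamma>.\<close>
      have eq: "?w (lift (q * f)) = ?w (lift r)"
      proof (rule ccontr)
        assume ne: "?w (lift (q * f)) \<noteq> ?w (lift r)"
        then have "?w (lift h) = min (\<nu> (q * f)) (\<nu> r)"
          unfolding h lift_add by (simp add: ball.add_eq_min wqf w)
        also have "\<dots> = \<nu> h"
          using ne unfolding h by (simp add: \<nu>.add_eq_min wqf w)
        finally show False
          using wh by simp
      qed
      have "\<nu> r \<le> ?w (lift h)"
        using ball.add_ge[of c \<gamma> "lift (q * f)" "lift r"] eq unfolding h lift_add by (simp add: w)
      then have lt: "?w' (lift r) < ?w' (lift h)"
        using wh IH \<delta>(2) by simp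
      have qf: "lift q * lift f = lift h - lift r"
        by (simp add: h lift_add lift_mult)
      have "ball_unit c \<delta> (lift q * lift f)"
        unfolding qf using IH lt \<open>r \<noteq> 0\<close> by (intro ball_unit_diff) auto
      then have u: "ball_unit c \<delta> (lift f)"
        using \<open>q \<noteq> 0\<close> less.prems by (simp add: ball_unit_mult_iff)
      have "?w' (lift q * lift f) = \<nu> r"
        unfolding qf using lt IH by (simp add: ball.diff_eq_right)
      \<comment> \<open>The product has the value \<open>\<nu> r\<close> at both radii while each
        factor can only grow, so neither grows.\<close>
      then have "?w (lift q) + ?w (lift f) = ?w' (lift q) + ?w' (lift f)"
        using eq by (simp add: lift_mult ball.mult w)
      then have "?w (lift f) = ?w' (lift f)"
        using above[OF \<gamma>(1)] \<open>q \<noteq> 0\<close> less.prems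
        by (elim top_add_eq_imp_eq(2)[OF ball_val_mono ball_val_mono, rotated 2]) (auto simp: ball.eq_Top_iff)
      then show ?thesis
        using u w by simp
    qed
  qed
  \<comment> \<open>Division by \<open>h\<close> gives a multiple of the nonunit \<open>h\<close>
    and a unit remainder; the value of their sum is exactly the minimum.\<close>
  have "ball_val c \<delta> (lift p) \<le> \<nu> p" for p
  proof (induction "degree p" arbitrary: p rule: less_induct)
    case IH: less
    consider "p = 0" | "p \<noteq> 0" "degree p < degree h" | "p \<noteq> 0" "degree h \<le> degree p"
      by linarith
    then show ?case
    proof cases
      case 1
      then show ?thesis by simp
    next
      case 2
      then show ?thesis
        using unit by simp
    next
      case 3
      define q r where "q = p div h" and "r = p mod h"
      have p: "p = q * h + r"
        by (simp add: q_def r_def)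
      have r: "r = 0 \<or> degree r < degree h"
        unfolding r_def using degree_mod_less[OF \<open>h \<noteq> 0\<close>] .
      have "q \<noteq> 0"
        using p r 3 \<open>degree h > 0\<close> by auto
      then have deg_qh: "degree (q * h) = degree q + degree h"
        using \<open>h \<noteq> 0\<close> by (simp add: degree_mult_eq)
      have "degree p = degree (q * h)"
        unfolding p using r deg_qh degree_add_eq_left[of r "q * h"] by (cases "r = 0") auto
      then have "ball_val c \<delta> (lift q) \<le> \<nu> q"
        using deg_qh \<open>degree h > 0\<close> by (intro IH) simp
      then have qh: "ball_val c \<delta> (lift (q * h)) \<le> \<nu> (q * h)"
        by (simp add: lift_mult ball.mult \<nu>.mult \<delta>(2) add_right_mono)
      show ?thesis
      proof (cases "r = 0")
        case True
        then show ?thesis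
          using qh p by simp
      next
        case False
        then have u: "ball_val c \<delta> (lift r) = \<nu> r" "ball_unit c \<delta> (lift r)"
          using unit r by auto
        have "\<not> ball_unit c \<delta> (lift (q * h))"
          using \<delta>(3) \<open>q \<noteq> 0\<close> \<open>h \<noteq> 0\<close> by (simp add: lift_mult ball_unit_mult_iff)
        then have "ball_val c \<delta> (lift p) = min (ball_val c \<delta> (lift (q * h))) (\<nu> r)"
          unfolding p lift_add using u \<open>q \<noteq> 0\<close> \<open>h \<noteq> 0\<close> by (subst ball_val_add_nonunit) auto
        also have "\<dots> \<le> min (\<nu> (q * h)) (\<nu> r)"
          using qh by (intro min.mono) auto
        also have "\<dots> \<le> \<nu> p"
          unfolding p by (rule \<nu>.add_ge)
        finally show ?thesis .
      qed
    qed
  qed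
  with above \<delta>(4) show ?thesis
    by blast
qed

subsection \<open>Extensions above and below given ones\<close>

text \<open>The form in which valuation-transcendence is used below: one polynomial \<phi> witnesses
  strictness for every valuation below \<nu>, hence uniformly along a chain.\<close>

definition detects :: "('k poly \<Rightarrow> 'g top) \<Rightarrow> 'k poly \<Rightarrow> bool" where
  "detects \<nu> \<phi> \<longleftrightarrow> (\<forall>\<rho>. ring_valuation \<rho> \<longrightarrow> (\<forall>c. \<rho> [:c:] = v c) \<longrightarrow> (\<forall>p. \<rho> p \<le> \<nu> p) \<longrightarrow>
     \<rho> \<phi> = \<nu> \<phi> \<longrightarrow> \<rho> = \<nu>)"

lemma detects_less:
  assumes "detects \<nu> \<phi>" "\<And>p. ball_val a \<gamma> (lift p) \<le> \<nu> p" "(\<lambda>p. ball_val a \<gamma> (lift p)) \<noteq> \<nu>"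
  shows "ball_val a \<gamma> (lift \<phi>) < \<nu> \<phi>"
proof (rule ccontr)
  assume "\<not> ?thesis"
  then have "ball_val a \<gamma> (lift \<phi>) = \<nu> \<phi>"
    using assms(2)[of \<phi>] by simp
  then have "(\<lambda>p. ball_val a \<gamma> (lift p)) = \<nu>"
    using assms(1,2) lift_ring_valuation[OF ball_val_ring_valuation, of a \<gamma>]
    unfolding detects_def by (simp add: v'_\<iota>)
  then show False
    using assms(3) by simp
qed

lemma least_degree_exists:
  fixes M :: "('l poly \<Rightarrow> 'g top) set"
  assumes "\<And>w p. w \<in> M \<Longrightarrow> w (lift p) \<le> \<nu> p" "\<And>w. w \<in> M \<Longrightarrow> w (lift \<phi>) < \<nu> \<phi>"
  shows "\<exists>h. (\<forall>w\<in>M. w (lift h) < \<nu> h) \<and> (\<forall>f. degree f < degree h \<longrightarrow> (\<exists>w\<in>M. w (lift f) = \<nu> f))"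
proof -
  define P where "P h \<longleftrightarrow> (\<forall>w\<in>M. w (lift h) < \<nu> h)" for h
  have "P \<phi>"
    using assms(2) by (simp add: P_def)
  then obtain h where h: "P h" "\<And>f. P f \<Longrightarrow> degree h \<le> degree f"
    using ex_has_least_nat[of P \<phi> degree] by blast
  have "\<exists>w\<in>M. w (lift f) = \<nu> f" if "degree f < degree h" for f
    using h(2)[of f] that assms(1) unfolding P_def by (metis leD order.not_eq_order_implies_strict)
  then show ?thesis
    using h(1) unfolding P_def by blast
qed

text \<open>With centre \<open>0\<close> the ball valuation restricts to a Gauss valuation over
  \<open>K\<close>, which is minimal among extensions. This supplies a first ball below
  \<nu>.\<close>

lemma gauss_lift_le:
  assumes "ring_valuation \<nu>" "\<And>c. \<nu> [:c:] = v c" "top.Value \<gamma> \<le> \<nu> [:0, 1:]"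
  shows "ball_val 0 \<gamma> (lift p) \<le> \<nu> p"
proof -
  interpret K: gauss_setup v
    by (intro gauss_setup.intro ring_valuation_v)
  have "ball_val 0 \<gamma> (lift p) = gauss v \<gamma> p"
    by (simp add: ball_val_def gauss_def taylor_term_def coeff_map_poly v'_\<iota>)
  also have "\<dots> \<le> \<nu> (pcompose p [:0, 1:])"
    using assms by (intro K.gauss_le_pcompose)
  finally show ?thesis
    by simp
qed

text \<open>The centre \<open>b\<close> is kept and only the radius varies. If no radius gave \<nu>,
  the set of admissible radii could be augmented by one beyond all of them that is still
  admissible.\<close>

lemma ball_val_below:
  assumes \<nu>: "ring_valuation \<nu>" "\<And>c. \<nu> [:c:] = v c" and \<phi>: "detects \<nu> \<phi>"
    and le: "\<And>p. \<nu> p \<le> ball_val b \<beta> (lift p)"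
  shows "\<exists>\<gamma>\<le>\<beta>. (\<lambda>p. ball_val b \<gamma> (lift p)) = \<nu>"
proof (rule ccontr)
  assume contra: "\<not> ?thesis"
  interpret \<nu>: ring_valuation \<nu> by fact
  define \<Gamma> where "\<Gamma> = {\<gamma>. \<gamma> \<le> \<beta> \<and> (\<forall>p. ball_val b \<gamma> (lift p) \<le> \<nu> p)}"
  have below: "\<exists>y\<le>x. top.Value y \<le> t" for x :: 'g and t
  proof (cases t)
    case (Value z)
    then show ?thesis
      by (intro exI[of _ "min x z"]) simp
  qed auto
  \<comment> \<open>A radius is sought small enough for the ball around \<open>b\<close> to contain
    \<open>0\<close> and for the Gauss valuation to lie below \<nu>.\<close>
  obtain x where x: "x \<le> \<beta>" "top.Value x \<le> \<nu> [:0, 1:]"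
    using below by blast
  obtain y where y: "y \<le> x" "top.Value y \<le> v' b"
    using below by blast
  have "y \<le> \<beta>" "top.Value y \<le> \<nu> [:0, 1:]"
    using x y by (auto intro: order.trans[of _ "top.Value x"])
  with y obtain \<gamma>\<^sub>0 where \<gamma>\<^sub>0: "\<gamma>\<^sub>0 \<le> \<beta>" "top.Value \<gamma>\<^sub>0 \<le> \<nu> [:0, 1:]" "top.Value \<gamma>\<^sub>0 \<le> v' b"
    by blast
  have "ball_val b \<gamma>\<^sub>0 = ball_val 0 \<gamma>\<^sub>0"
    using \<gamma>\<^sub>0 by (intro ball_val_recenter) simp
  then have "\<gamma>\<^sub>0 \<in> \<Gamma>"
    using \<gamma>\<^sub>0 \<nu> by (simp add: \<Gamma>_def gauss_lift_le)
  then have ne: "\<Gamma> \<noteq> {}"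
    by auto
  have good: "ball_val b \<gamma> (lift p) \<le> \<nu> p" if "\<gamma> \<in> \<Gamma>" for \<gamma> p
    using that by (simp add: \<Gamma>_def)
  have less: "ball_val b \<gamma> (lift \<phi>) < \<nu> \<phi>" if "\<gamma> \<in> \<Gamma>" for \<gamma>
  proof (rule detects_less[OF \<phi> good[OF that]])
    show "(\<lambda>p. ball_val b \<gamma> (lift p)) \<noteq> \<nu>"
      using that contra by (auto simp: \<Gamma>_def)
  qed
  have "\<exists>h. (\<forall>w\<in>ball_val b ` \<Gamma>. w (lift h) < \<nu> h) \<and>
      (\<forall>f. degree f < degree h \<longrightarrow> (\<exists>w\<in>ball_val b ` \<Gamma>. w (lift f) = \<nu> f))"
    using good less by (intro least_degree_exists[of _ _ \<phi>]) auto
  then obtain h where h: "\<forall>w\<in>ball_val b ` \<Gamma>. w (lift h) < \<nu> h"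
    "\<forall>f. degree f < degree h \<longrightarrow> (\<exists>w\<in>ball_val b ` \<Gamma>. w (lift f) = \<nu> f)"
    by blast
  have "\<exists>\<delta>. (\<forall>\<gamma>\<in>\<Gamma>. \<gamma> < \<delta>) \<and> (\<forall>p. ball_val b \<delta> (lift p) \<le> \<nu> p) \<and>
    (\<forall>\<delta>'. \<nu> h \<le> ball_val b \<delta>' (lift h) \<longrightarrow> \<delta> \<le> \<delta>')"
  proof (rule ball_val_augment[OF \<nu> ne good])
    show "ball_val b \<gamma> (lift h) < \<nu> h" if "\<gamma> \<in> \<Gamma>" for \<gamma>
      using h(1) that by blast
    show "\<exists>\<gamma>\<in>\<Gamma>. ball_val b \<gamma> (lift f) = \<nu> f" if "degree f < degree h" for f
      using h(2) that by blast
    show "\<nu> h \<le> v' (poly (lift h) b)"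
      using le[of h] ball_val_le_poly by (rule order.trans)
  qed
  then obtain \<delta> where \<delta>: "\<forall>\<gamma>\<in>\<Gamma>. \<gamma> < \<delta>" "\<And>p. ball_val b \<delta> (lift p) \<le> \<nu> p"
    "\<And>\<delta>'. \<nu> h \<le> ball_val b \<delta>' (lift h) \<Longrightarrow> \<delta> \<le> \<delta>'"
    by blast
  \<comment> \<open>At radius \<beta> the value of \<open>h\<close> is at least
    \<open>\<nu> h\<close>, so minimality gives \<open>\<delta> \<le> \<beta>\<close>.\<close>
  have "\<delta> \<in> \<Gamma>"
    using \<delta>(2,3) le[of h] by (simp add: \<Gamma>_def)
  then show False
    using \<delta>(1) by blast
qed

definition is_ball_val :: "('l poly \<Rightarrow> 'g top) \<Rightarrow> bool" where
  "is_ball_val w \<longleftrightarrow> (\<exists>a \<gamma>. w = ball_val a \<gamma>)"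

lemma is_ball_val_ball_val [simp]: "is_ball_val (ball_val a \<gamma>)"
  by (auto simp: is_ball_val_def)

lemma is_ball_val_ring_valuation: "is_ball_val w \<Longrightarrow> ring_valuation w"
  by (auto simp: is_ball_val_def ball_val_ring_valuation)

lemma is_ball_val_const: "is_ball_val w \<Longrightarrow> w [:c:] = v' c"
  by (auto simp: is_ball_val_def)

lemma is_ball_val_rigid:
  assumes "is_ball_val w" "is_ball_val w'" "w \<le> w'" "(\<lambda>p. w (lift p)) = (\<lambda>p. w' (lift p))"
  shows "w = w'"
  using assms
  by (intro ring_valuation_rigid is_ball_val_ring_valuation)
    (auto simp: is_ball_val_const dest: le_funD fun_cong)

text \<open>Balls containing a common ball can be centred at its centre \<open>b\<close> and are
  then ordered by radius.\<close>

lemma ball_vals_below_total: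
  assumes "is_ball_val w" "is_ball_val w'" "w \<le> ball_val b \<beta>" "w' \<le> ball_val b \<beta>"
  shows "w \<le> w' \<or> w' \<le> w"
proof -
  obtain a \<gamma> a' \<gamma>' where "w = ball_val a \<gamma>" "w' = ball_val a' \<gamma>'"
    using assms by (auto simp: is_ball_val_def)
  then have "w = ball_val b \<gamma>" "w' = ball_val b \<gamma>'"
    using assms ball_val_le_imp(3) by blast+
  then show ?thesis
    using ball_val_mono[of \<gamma> \<gamma>' b] ball_val_mono[of \<gamma>' \<gamma> b] linear[of \<gamma> \<gamma>'] by (auto simp: le_fun_def)
qed

text \<open>No centre is available in advance here; it is found as a common root of a polynomial of
  least degree.\<close>

lemma ball_val_above:
  assumes \<nu>: "ring_valuation \<nu>" "\<And>c. \<nu> [:c:] = v c" and \<phi>: "detects \<nu> \<phi>"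
    and C: "C \<noteq> {}" "\<And>w. w \<in> C \<Longrightarrow> is_ball_val w" "\<And>w p. w \<in> C \<Longrightarrow> w (lift p) \<le> \<nu> p"
      "\<And>w w'. w \<in> C \<Longrightarrow> w' \<in> C \<Longrightarrow> w \<le> w' \<or> w' \<le> w"
  shows "\<exists>w. is_ball_val w \<and> (\<lambda>p. w (lift p)) = \<nu> \<and> (\<forall>u\<in>C. u \<le> w)"
proof -
  \<comment> \<open>Comparability with every member of \<open>C\<close> is built in, so that any
    maximal chain in \<open>A\<close> contains \<open>C\<close>.\<close>
  define A where "A = {w. is_ball_val w \<and> (\<forall>p. w (lift p) \<le> \<nu> p) \<and> (\<forall>u\<in>C. w \<le> u \<or> u \<le> w)}"
  interpret pred_on A "(<)" .
  obtain M where M: "maxchain M"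
    using Hausdorff by blast
  then have MA: "M \<subseteq> A" and M_total: "\<And>w w'. w \<in> M \<Longrightarrow> w' \<in> M \<Longrightarrow> w \<le> w' \<or> w' \<le> w"
    unfolding maxchain_def chain_def by (auto simp: less_le)
  have maximal: "u \<in> M" if "u \<in> A" "\<And>w. w \<in> M \<Longrightarrow> w \<le> u \<or> u \<le> w" for u
  proof (rule ccontr)
    assume "u \<notin> M"
    moreover have "chain (insert u M)"
      unfolding chain_def using that MA M_total by (auto simp: less_le)
    ultimately show False
      using M unfolding maxchain_def by blast
  qed
  have CM: "C \<subseteq> M"
  proof
    fix u
    assume u: "u \<in> C"
    show "u \<in> M"
    proof (rule maximal)
      show "u \<in> A"
        using u C(2-4) by (simp add: A_def)
      show "w \<le> u \<or> u \<le> w" if "w \<in> M" for w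
        using that u MA unfolding A_def by blast
    qed
  qed
  have good: "w (lift p) \<le> \<nu> p" if "w \<in> M" for w p
    using that MA by (auto simp: A_def)
  have "\<exists>w\<in>A. (\<lambda>p. w (lift p)) = \<nu>"
  proof (rule ccontr)
    assume contra: "\<not> ?thesis"
    have less: "w (lift \<phi>) < \<nu> \<phi>" if "w \<in> M" for w
    proof -
      from that MA have "is_ball_val w"
        by (auto simp: A_def)
      then obtain a \<gamma> where w: "w = ball_val a \<gamma>"
        by (auto simp: is_ball_val_def)
      show ?thesis
        unfolding w
      proof (rule detects_less[OF \<phi>])
        show "ball_val a \<gamma> (lift p) \<le> \<nu> p" for p
          using good[OF that] by (simp add: w)
        show "(\<lambda>p. ball_val a \<gamma> (lift p)) \<noteq> \<nu>"
          using contra that MA w by blast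
      qed
    qed
    have "\<exists>h. (\<forall>w\<in>M. w (lift h) < \<nu> h) \<and> (\<forall>f. degree f < degree h \<longrightarrow> (\<exists>w\<in>M. w (lift f) = \<nu> f))"
      using good less by (intro least_degree_exists[of M \<nu> \<phi>])
    then obtain h where h: "\<forall>w\<in>M. w (lift h) < \<nu> h"
      "\<forall>f. degree f < degree h \<longrightarrow> (\<exists>w\<in>M. w (lift f) = \<nu> f)"
      by blast
    \<comment> \<open>The roots of \<open>h\<close> in the ball of \<open>w\<close>, described as
      those that may serve as its centre.\<close>
    define R where "R w = {c. poly (lift h) c = 0 \<and> (\<exists>\<gamma>. w = ball_val c \<gamma>)}" for w
    obtain w where "w \<in> M"
      using C(1) CM by blast
    then have "is_ball_val w"
      using MA by (auto simp: A_def)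
    then have "w 0 = top.Top"
      by (intro ring_valuation.zero is_ball_val_ring_valuation)
    then have "h \<noteq> 0"
      using h(1) \<open>w \<in> M\<close> by auto
    then have "finite {c. poly (lift h) c = 0}"
      by (intro poly_roots_finite) simp
    then have fin: "finite (R w)" for w
      by (rule rev_finite_subset) (auto simp: R_def)
    have R_ne: "R w \<noteq> {}" if "w \<in> M" for w
    proof -
      from that MA have "is_ball_val w"
        by (auto simp: A_def)
      then obtain a \<gamma> where w: "w = ball_val a \<gamma>"
        by (auto simp: is_ball_val_def)
      have "\<exists>c. poly (lift h) c = 0 \<and> top.Value \<gamma> \<le> v' (a - c)"
        using h(1) good[OF that] that unfolding w by (intro ball_root_if_val_less[OF \<nu>(1) _ _ \<nu>(2)]) auto
      then obtain c where c: "poly (lift h) c = 0" "top.Value \<gamma> \<le> v' (a - c)"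
        by blast
      then have "w = ball_val c \<gamma>"
        unfolding w by (intro ball_val_recenter)
      then show ?thesis
        using c by (auto simp: R_def)
    qed
    have R_anti: "R w' \<subseteq> R w" if "w \<in> M" "w \<le> w'" for w w'
      using that MA ball_val_le_imp(3) unfolding R_def A_def is_ball_val_def by blast
    \<comment> \<open>The finite root sets form a chain, so one of least size is contained in all
      others and yields the common centre.\<close>
    obtain w\<^sub>0 where w\<^sub>0: "w\<^sub>0 \<in> M" "\<And>w. w \<in> M \<Longrightarrow> card (R w\<^sub>0) \<le> card (R w)"
      using ex_has_least_nat[of "\<lambda>w. w \<in> M" w "\<lambda>w. card (R w)"] \<open>w \<in> M\<close> by blast
    have "R w\<^sub>0 \<subseteq> R w" if "w \<in> M" for w
    proof (cases "w \<le> w\<^sub>0")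
      case True
      then show ?thesis
        using R_anti that by blast
    next
      case False
      then have "R w \<subseteq> R w\<^sub>0"
        using R_anti M_total that w\<^sub>0(1) by blast
      then show ?thesis
        using card_seteq[OF fin] w\<^sub>0(2)[OF that] by blast
    qed
    then obtain c where c: "\<And>w. w \<in> M \<Longrightarrow> c \<in> R w"
      using R_ne[OF w\<^sub>0(1)] by blast
    define \<Gamma> where "\<Gamma> = {\<gamma>. ball_val c \<gamma> \<in> M}"
    have M_eq: "M = ball_val c ` \<Gamma>"
      using c by (auto simp: \<Gamma>_def R_def)
    have "\<exists>\<delta>. (\<forall>\<gamma>\<in>\<Gamma>. \<gamma> < \<delta>) \<and> (\<forall>p. ball_val c \<delta> (lift p) \<le> \<nu> p) \<and>
      (\<forall>\<delta>'. \<nu> h \<le> ball_val c \<delta>' (lift h) \<longrightarrow> \<delta> \<le> \<delta>')"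
    proof (rule ball_val_augment[OF \<nu>, of \<Gamma> c h])
      show "\<Gamma> \<noteq> {}"
        using \<open>w \<in> M\<close> M_eq by auto
      show "ball_val c \<gamma> (lift p) \<le> \<nu> p" if "\<gamma> \<in> \<Gamma>" for \<gamma> p
        using good that by (simp add: \<Gamma>_def)
      show "ball_val c \<gamma> (lift h) < \<nu> h" if "\<gamma> \<in> \<Gamma>" for \<gamma>
        using h(1) that by (simp add: \<Gamma>_def)
      show "\<exists>\<gamma>\<in>\<Gamma>. ball_val c \<gamma> (lift f) = \<nu> f" if "degree f < degree h" for f
        using h(2) that M_eq by blast
      show "\<nu> h \<le> v' (poly (lift h) c)"
        using c[OF \<open>w \<in> M\<close>] by (simp add: R_def)
    qed
    then obtain \<delta> where \<delta>: "\<forall>\<gamma>\<in>\<Gamma>. \<gamma> < \<delta>" "\<And>p. ball_val c \<delta> (lift p) \<le> \<nu> p"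
      by blast
    \<comment> \<open>The new ball valuation lies above the whole chain, so maximality puts it in
      \<open>M\<close>; its radius would then be smaller than itself.\<close>
    have above: "u \<le> ball_val c \<delta>" if "u \<in> M" for u
      using that \<delta>(1) unfolding M_eq by (auto simp: le_fun_def less_imp_le ball_val_mono)
    then have "ball_val c \<delta> \<in> A"
      using \<delta>(2) CM by (auto simp: A_def)
    then have "ball_val c \<delta> \<in> M"
      using above by (intro maximal) auto
    then show False
      using \<delta>(1) by (metis \<Gamma>_def mem_Collect_eq less_irrefl)
  qed
  then obtain w where w: "w \<in> A" "(\<lambda>p. w (lift p)) = \<nu>"
    by blast
  \<comment> \<open>Otherwise \<open>w\<close> lies below \<open>u\<close>; both then restrict to
    \<nu>, and rigidity makes them equal.\<close>
  have "u \<le> w" if "u \<in> C" for u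
  proof (rule ccontr)
    assume *: "\<not> u \<le> w"
    then have "w \<le> u"
      using w that by (auto simp: A_def)
    moreover have "w (lift p) = u (lift p)" for p
      using le_funD[OF \<open>w \<le> u\<close>, of "lift p"] C(3)[OF that, of p] fun_cong[OF w(2), of p] by simp
    ultimately have "w = u"
      using w C(2)[OF that] by (intro is_ball_val_rigid) (auto simp: A_def)
    then show False
      using * by simp
  qed
  then show ?thesis
    using w by (auto simp: A_def)
qed

end

subsection \<open>Families of extensions\<close>

text \<open>The value of \<open>a / b\<close> is the \<open>t\<close> with
  \<open>t + w b = w a\<close>, a form that avoids subtracting from infinity. Cross-multiplication
  shows independence of the representation.\<close>

lemma ring_valuation_extends_to_fract:
  fixes w :: "'a::idom \<Rightarrow> 'g::linordered_ab_group_add top"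
  assumes "ring_valuation w"
  shows "\<exists>\<mu>. valuation \<mu> \<and> (\<forall>p. \<mu> (to_fract p) = w p)"
proof -
  interpret w: ring_valuation w by fact
  define P where "P z t \<longleftrightarrow> (\<exists>a b. b \<noteq> 0 \<and> z = to_fract a / to_fract b \<and> t + w b = w a)" for z t
  have P_unique: "t = t'" if t: "P z t" and t': "P z t'" for z t t'
  proof -
    obtain a b where ab: "b \<noteq> 0" "z = to_fract a / to_fract b" "t + w b = w a"
      using t unfolding P_def by blast
    obtain c d where cd: "d \<noteq> 0" "z = to_fract c / to_fract d" "t' + w d = w c"
      using t' unfolding P_def by blast
    have "to_fract (a * d) = to_fract (c * b)"
      using ab(1,2) cd(1,2) by (simp add: field_simps)
    then have "a * d = c * b"
      by (simp only: to_fract_eq_iff)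
    then have "w a + w d = w c + w b"
      by (metis w.mult)
    then have "t + (w b + w d) = t' + (w b + w d)"
      unfolding ab(3)[symmetric] cd(3)[symmetric] by (simp add: add_ac)
    then show ?thesis
      using ab(1) cd(1) by (subst (asm) top_add_right_cancel) (simp_all add: w.eq_Top_iff)
  qed
  have P_exists: "\<exists>t. P z t" for z
  proof -
    obtain a b where ab: "z = Fract a b" "b \<noteq> 0"
      by (cases z)
    then show ?thesis
      using top_diff_exists[of "w b" "w a"] w.eq_Top_iff[of b] unfolding P_def by (metis Fract_conv_to_fract)
  qed
  define \<mu> where "\<mu> z = (SOME t. P z t)" for z
  have P_\<mu>: "P z (\<mu> z)" for z
    unfolding \<mu>_def using P_exists by (rule someI_ex)
  have \<mu>_eq: "\<mu> (to_fract a / to_fract b) + w b = w a" if "b \<noteq> 0" for a b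
  proof -
    from that obtain t where "t + w b = w a"
      using top_diff_exists[of "w b" "w a"] w.eq_Top_iff[of b] by blast
    moreover from this have "P (to_fract a / to_fract b) t"
      using that by (auto simp: P_def)
    then have "t = \<mu> (to_fract a / to_fract b)"
      using P_\<mu> by (rule P_unique)
    ultimately show ?thesis
      by simp
  qed
  have "valuation \<mu>"
    unfolding valuation_def
  proof (intro conjI allI)
    fix z z' :: "'a fract"
    obtain a b where ab: "z = to_fract a / to_fract b" "b \<noteq> 0"
      by (cases z) (simp add: Fract_conv_to_fract)
    obtain c d where cd: "z' = to_fract c / to_fract d" "d \<noteq> 0"
      by (cases z') (simp add: Fract_conv_to_fract)
    have bd: "w (b * d) \<noteq> top.Top"
      using ab cd by (simp add: w.eq_Top_iff)
    have "\<mu> z = top.Top \<longleftrightarrow> w a = top.Top"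
      using \<mu>_eq[OF ab(2), of a] ab by (metis top_add_eq_Top w.eq_Top_iff)
    then show "\<mu> z = top.Top \<longleftrightarrow> z = 0"
      using ab by (simp add: w.eq_Top_iff)
    have za: "\<mu> z + w b = w a" and zc: "\<mu> z' + w d = w c"
      using ab cd \<mu>_eq by simp_all
    have "\<mu> (z * z') + w (b * d) = w (a * c)"
      using \<mu>_eq[of "b * d" "a * c"] ab cd by simp
    also have "\<dots> = (\<mu> z + \<mu> z') + w (b * d)"
      unfolding w.mult za[symmetric] zc[symmetric] by (simp add: add_ac)
    finally show "\<mu> (z * z') = \<mu> z + \<mu> z'"
      using top_add_right_cancel[OF bd] by blast
    have "min (\<mu> z) (\<mu> z') + w (b * d) = min (w (a * d)) (w (c * b))"
    proof -
      have "\<mu> z + w (b * d) = w (a * d)" "\<mu> z' + w (b * d) = w (c * b)"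
        unfolding w.mult za[symmetric] zc[symmetric] by (simp_all add: add_ac)
      moreover have "min (\<mu> z) (\<mu> z') + w (b * d) = min (\<mu> z + w (b * d)) (\<mu> z' + w (b * d))"
        using bd by (simp add: min_def top_add_le_cancel_right)
      ultimately show ?thesis
        by simp
    qed
    also have "\<dots> \<le> w (a * d + c * b)"
      by (rule w.add_ge)
    also have "\<dots> = \<mu> (z + z') + w (b * d)"
    proof -
      have "z + z' = to_fract (a * d + c * b) / to_fract (b * d)"
        using ab cd by (simp add: add_frac_eq)
      then show ?thesis
        using \<mu>_eq[of "b * d" "a * d + c * b"] ab cd by simp
    qed
    finally show "min (\<mu> z) (\<mu> z') \<le> \<mu> (z + z')"
      using top_add_le_cancel_right[OF bd] by blast
  qed
  moreover have "\<mu> (to_fract p) = w p" for p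
    using \<mu>_eq[of 1 p] by simp
  ultimately show ?thesis
    by blast
qed

lemma valuation_eq_if_eq_to_fract:
  fixes \<mu> \<mu>' :: "'a::idom fract \<Rightarrow> 'g::linordered_ab_group_add top"
  assumes "valuation \<mu>" "valuation \<mu>'" "\<And>p. \<mu> (to_fract p) = \<mu>' (to_fract p)"
  shows "\<mu> = \<mu>'"
proof
  fix z :: "'a fract"
  interpret \<mu>: ring_valuation \<mu>
    using assms by (simp add: valuation_iff_ring_valuation)
  interpret \<mu>': ring_valuation \<mu>'
    using assms by (simp add: valuation_iff_ring_valuation)
  obtain a b where z: "z = to_fract a / to_fract b" "b \<noteq> 0"
    by (cases z) (simp add: Fract_conv_to_fract)
  then have "to_fract a = z * to_fract b"
    by simp
  then have "\<mu> z + \<mu> (to_fract b) = \<mu>' z + \<mu> (to_fract b)"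
    using assms(3)[of a] assms(3)[of b] by (simp add: \<mu>.mult \<mu>'.mult)
  then show "\<mu> z = \<mu>' z"
    using z(2) by (subst (asm) top_add_right_cancel) (simp_all add: \<mu>.eq_Top_iff)
qed

lemma valuation_restrict_poly:
  assumes "\<mu> \<in> valuation_extensions const_fract v"
  shows "ring_valuation (\<lambda>p. \<mu> (to_fract p))" "\<mu> (to_fract [:c:]) = v c"
proof -
  interpret \<mu>: ring_valuation \<mu>
    using assms by (simp add: valuation_extensions_def valuation_iff_ring_valuation)
  show "ring_valuation (\<lambda>p. \<mu> (to_fract p))"
    by standard (simp_all add: \<mu>.eq_Top_iff \<mu>.mult \<mu>.add_ge)
  show "\<mu> (to_fract [:c:]) = v c"
    using assms by (simp add: valuation_extensions_def const_fract_def)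
qed

section \<open>From detecting polynomials to the family of extensions\<close>

context valued_closure
begin

text \<open>The transcendental element is written as \<open>f / g\<close>, and \<phi> is
  \<open>f * g\<close>. Multiplying a polynomial expression of degree \<open>n\<close> by
  \<open>g ^ n\<close> clears denominators and shifts all values equally.\<close>

lemma detects_exists:
  assumes \<mu>: "\<mu> \<in> valuation_extensions const_fract v" "valuation_transcendental v \<mu>"
  shows "\<exists>\<phi>. \<phi> \<noteq> 0 \<and> detects (\<lambda>p. \<mu> (to_fract p)) \<phi>"
proof -
  note \<mu>_poly = valuation_restrict_poly[OF \<mu>(1)]
  interpret \<mu>: ring_valuation \<mu>
    using \<mu>(1) by (simp add: valuation_extensions_def valuation_iff_ring_valuation)
  have v: "valuation v"
    using ring_valuation_v by (simp add: valuation_iff_ring_valuation)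
  obtain \<alpha> where \<alpha>: "\<alpha> \<noteq> 0"
    "\<And>n c k. k \<le> n \<Longrightarrow> \<mu> (\<Sum>i\<le>n. const_fract (c i) * \<alpha> ^ i) \<le> \<mu> (const_fract (c k) * \<alpha> ^ k)"
    using valuation_transcendental_element[OF v \<mu>] by blast
  obtain f g where fg: "\<alpha> = to_fract f / to_fract g" "g \<noteq> 0"
    by (cases \<alpha>) (simp add: Fract_conv_to_fract)
  then have "f \<noteq> 0"
    using \<alpha>(1) by auto
  have monom: "to_fract ([:c:] * f ^ k * g ^ (n - k)) = to_fract g ^ n * (const_fract c * \<alpha> ^ k)" if "k \<le> n" for c k n
  proof -
    have pow: "to_fract (p ^ m) = to_fract p ^ m" for p :: "'k poly" and m
      by (induction m) simp_all
    have "to_fract g ^ n = to_fract g ^ k * to_fract g ^ (n - k)"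
      using that by (simp flip: power_add)
    then show ?thesis
      using fg(2) by (simp only: to_fract_mult pow) (simp add: fg(1) power_divide const_fract_def)
  qed
  have "detects (\<lambda>p. \<mu> (to_fract p)) (f * g)"
    unfolding detects_def
  proof (intro allI impI)
    fix \<rho> :: "'k poly \<Rightarrow> 'g top"
    assume \<rho>: "ring_valuation \<rho>" "\<forall>c. \<rho> [:c:] = v c" "\<forall>p. \<rho> p \<le> \<mu> (to_fract p)"
      "\<rho> (f * g) = \<mu> (to_fract (f * g))"
    show "\<rho> = (\<lambda>p. \<mu> (to_fract p))"
    proof (rule transcendental_val_detects[OF ring_valuation_v, of _ _ f g])
      fix n and c :: "nat \<Rightarrow> 'k" and k :: nat
      assume "k \<le> n"
      have "(\<Sum>k\<le>n. to_fract ([:c k:] * f ^ k * g ^ (n - k))) = to_fract g ^ n * (\<Sum>k\<le>n. const_fract (c k) * \<alpha> ^ k)"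
        unfolding sum_distrib_left by (intro sum.cong refl monom) simp
      then show "\<mu> (to_fract (\<Sum>k\<le>n. [:c k:] * f ^ k * g ^ (n - k))) \<le> \<mu> (to_fract ([:c k:] * f ^ k * g ^ (n - k)))"
        unfolding to_fract_sum monom[OF \<open>k \<le> n\<close>]
        using \<alpha>(2)[OF \<open>k \<le> n\<close>, of c] by (simp only: \<mu>.mult[of "to_fract g ^ n"] add_left_mono)
    qed (use \<rho> \<mu>_poly fg \<open>f \<noteq> 0\<close> in auto)
  qed
  then show ?thesis
    using fg(2) \<open>f \<noteq> 0\<close> by (intro exI[of _ "f * g"]) simp
qed

text \<open>Choose \<open>a\<close> among \<open>0\<close> and the roots of \<phi> with
  \<open>w (x - a)\<close> largest. The ball with this radius has the values of \<open>w\<close> at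
  all linear factors of \<phi>, hence at \<phi>; \<open>detects\<close> and rigidity do the
  rest.\<close>

lemma is_ball_val_if_detects:
  assumes w: "ring_valuation w" "\<And>c. w [:c:] = v' c" and \<phi>: "\<phi> \<noteq> 0" "detects (\<lambda>p. w (lift p)) \<phi>"
  shows "is_ball_val w"
proof -
  interpret w: ring_valuation w by fact
  \<comment> \<open>The point \<open>0\<close> keeps the set nonempty when \<phi> is
    constant.\<close>
  define S where "S = insert 0 {c. poly (lift \<phi>) c = 0}"
  have fin: "finite S"
    unfolding S_def using \<phi> by (simp add: poly_roots_finite)
  let ?W = "(\<lambda>c. w [:- c, 1:]) ` S"
  have "Max ?W \<in> ?W"
    using fin by (intro Max_in) (auto simp: S_def)
  then obtain a where a: "Max ?W = w [:- a, 1:]"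
    by (elim imageE)
  have "w [:- a, 1:] \<noteq> top.Top"
    by (simp add: w.eq_Top_iff)
  then obtain \<gamma> where \<gamma>: "w [:- a, 1:] = top.Value \<gamma>"
    by (cases "w [:- a, 1:]") auto
  have le: "ball_val a \<gamma> p \<le> w p" for p
    using w \<gamma> by (intro ball_val_le) auto
  have linear: "ball_val a \<gamma> [:- c, 1:] = w [:- c, 1:]" if "poly (lift \<phi>) c = 0" for c
  proof (rule order.antisym[OF le])
    have "w [:- c, 1:] \<le> Max ?W"
      using fin that by (intro Max_ge) (auto simp: S_def)
    then have c: "w [:- c, 1:] \<le> top.Value \<gamma>"
      using a \<gamma> by simp
    have "min (w [:- c, 1:]) (w [:- a, 1:]) \<le> w ([:- c, 1:] - [:- a, 1:])"
      by (rule w.diff_ge)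
    then have "w [:- c, 1:] \<le> v' (a - c)"
      using c \<gamma> w(2)[of "a - c"] by simp
    then show "w [:- c, 1:] \<le> ball_val a \<gamma> [:- c, 1:]"
      using c by (simp add: ball_val_linear)
  qed
  have "ball_val a \<gamma> (lift \<phi>) = w (lift \<phi>)"
    by (rule ring_valuation_eq_on_roots[OF ball_val_ring_valuation w(1) _ _ linear]) (use \<phi>(1) in \<open>simp_all add: w(2)\<close>)
  then have "(\<lambda>p. ball_val a \<gamma> (lift p)) = (\<lambda>p. w (lift p))"
    using \<phi>(2) le lift_ring_valuation[OF ball_val_ring_valuation, of a \<gamma>]
    unfolding detects_def by (simp add: v'_\<iota>)
  then have "ball_val a \<gamma> = w"
    using le by (intro ring_valuation_rigid ball_val_ring_valuation w) (auto dest: fun_cong)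
  then show ?thesis
    by (auto simp: is_ball_val_def)
qed

text \<open>A maximal chain of pairs omits no index: a missing one with a member above it is filled
  by \<open>ball_val_below\<close>, and any other by \<open>ball_val_above\<close> applied to the
  whole chain.\<close>

lemma ball_val_family:
  fixes \<nu> :: "'i::linorder \<Rightarrow> 'k poly \<Rightarrow> 'g top"
  assumes \<nu>: "\<And>i. ring_valuation (\<nu> i)" "\<And>i c. \<nu> i [:c:] = v c" "\<And>i. \<exists>\<phi>. detects (\<nu> i) \<phi>"
    and mono: "\<And>i j. i < j \<Longrightarrow> \<nu> i \<le> \<nu> j" "\<And>i j. i < j \<Longrightarrow> \<nu> i \<noteq> \<nu> j"
    and w\<^sub>0: "is_ball_val w\<^sub>0" "(\<lambda>p. w\<^sub>0 (lift p)) = \<nu> i\<^sub>0"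
  shows "\<exists>\<omega>. (\<forall>i. is_ball_val (\<omega> i) \<and> (\<lambda>p. \<omega> i (lift p)) = \<nu> i) \<and> (\<forall>i j. i < j \<longrightarrow> \<omega> i \<le> \<omega> j) \<and> \<omega> i\<^sub>0 = w\<^sub>0"
proof -
  \<comment> \<open>Strict in the index, so that a chain contains at most one pair for each
    index.\<close>
  define lt where "lt x y \<longleftrightarrow> fst x < fst y \<and> snd x \<le> snd y" for x y :: "'i \<times> ('l poly \<Rightarrow> 'g top)"
  \<comment> \<open>Comparability with the prescribed pair is built in, so every maximal chain
    contains it.\<close>
  define A where "A = {(i, w). is_ball_val w \<and> (\<lambda>p. w (lift p)) = \<nu> i \<and>
    ((i, w) = (i\<^sub>0, w\<^sub>0) \<or> lt (i, w) (i\<^sub>0, w\<^sub>0) \<or> lt (i\<^sub>0, w\<^sub>0) (i, w))}"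
  interpret pred_on A lt .
  obtain M where M: "maxchain M"
    using Hausdorff by blast
  have MA: "M \<subseteq> A"
    using M unfolding maxchain_def chain_def by blast
  have M_A: "is_ball_val w" "(\<lambda>p. w (lift p)) = \<nu> i" if "(i, w) \<in> M" for i w
    using that MA by (auto simp: A_def)
  have M_total: "x = y \<or> lt x y \<or> lt y x" if "x \<in> M" "y \<in> M" for x y
    using that M unfolding maxchain_def chain_def by auto
  have M_mono: "u \<le> w" if "(i, u) \<in> M" "(j, w) \<in> M" "i < j" for i j u w
    using M_total[OF that(1,2)] that(3) by (auto simp: lt_def)
  have maximal: "x \<in> M" if "x \<in> A" "\<And>y. y \<in> M \<Longrightarrow> x = y \<or> lt x y \<or> lt y x" for x
  proof (rule ccontr)
    assume "x \<notin> M"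
    moreover have "chain (insert x M)"
      using that M unfolding maxchain_def chain_def by auto
    ultimately show False
      using M unfolding maxchain_def by blast
  qed
  have i\<^sub>0: "(i\<^sub>0, w\<^sub>0) \<in> M"
  proof (rule maximal)
    show "(i\<^sub>0, w\<^sub>0) \<in> A"
      using w\<^sub>0 by (simp add: A_def)
    show "(i\<^sub>0, w\<^sub>0) = y \<or> lt (i\<^sub>0, w\<^sub>0) y \<or> lt y (i\<^sub>0, w\<^sub>0)" if "y \<in> M" for y
      using that MA by (auto simp: A_def)
  qed
  have insert_M: "(j, w) \<in> M"
    if w: "is_ball_val w" "(\<lambda>p. w (lift p)) = \<nu> j"
      and comparable: "\<And>i u. (i, u) \<in> M \<Longrightarrow> i < j \<Longrightarrow> u \<le> w" "\<And>i u. (i, u) \<in> M \<Longrightarrow> j < i \<Longrightarrow> w \<le> u"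
      and new: "\<And>u. (j, u) \<notin> M" for j w
  proof (rule maximal)
    show *: "(j, w) = y \<or> lt (j, w) y \<or> lt y (j, w)" if "y \<in> M" for y
    proof -
      obtain i u where y: "y = (i, u)"
        by (cases y)
      then have "i \<noteq> j"
        using that new by blast
      then show ?thesis
        using comparable that unfolding y by (auto simp: lt_def neq_iff)
    qed
    show "(j, w) \<in> A"
      using *[OF i\<^sub>0] w by (auto simp: A_def)
  qed
  \<comment> \<open>The restrictions decide the direction of any comparison between
    extensions.\<close>
  have not_le: "\<not> w \<le> u" if "(\<lambda>p. w (lift p)) = \<nu> j" "(\<lambda>p. u (lift p)) = \<nu> i" "i < j" for i j u w
  proof
    assume "w \<le> u"
    then have "\<nu> j \<le> \<nu> i"
      unfolding that(1)[symmetric] that(2)[symmetric] by (auto simp: le_fun_def)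
    then show False
      using mono[OF that(3)] by simp
  qed
  have "\<exists>w. (j, w) \<in> M" for j
  proof (rule ccontr)
    assume "\<nexists>w. (j, w) \<in> M"
    then have new: "(j, w) \<notin> M" for w
      by blast
    obtain \<phi> where \<phi>: "detects (\<nu> j) \<phi>"
      using \<nu>(3) by blast
    show False
    proof (cases "\<exists>k \<kappa>. (k, \<kappa>) \<in> M \<and> j < k")
      case True
      then obtain k \<kappa> where \<kappa>: "(k, \<kappa>) \<in> M" "j < k"
        by blast
      then obtain b \<beta> where b: "\<kappa> = ball_val b \<beta>"
        using M_A(1)[OF \<kappa>(1)] by (auto simp: is_ball_val_def)
      have "\<nu> j p \<le> ball_val b \<beta> (lift p)" for p
        using le_funD[OF mono(1)[OF \<kappa>(2)], of p] fun_cong[OF M_A(2)[OF \<kappa>(1)], of p] by (simp add: b)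
      then obtain \<gamma> where \<gamma>: "\<gamma> \<le> \<beta>" "(\<lambda>p. ball_val b \<gamma> (lift p)) = \<nu> j"
        using ball_val_below[OF \<nu>(1,2) \<phi>] by blast
      let ?w = "ball_val b \<gamma>"
      have w\<kappa>: "?w \<le> \<kappa>"
        using \<gamma>(1) by (auto simp: b le_fun_def ball_val_mono)
      have "(j, ?w) \<in> M"
      proof (rule insert_M[OF _ \<gamma>(2) _ _ new])
        \<comment> \<open>Both lie below \<kappa>, so they are comparable, and the restrictions
          exclude the wrong direction.\<close>
        show "u \<le> ?w" if u: "(i, u) \<in> M" "i < j" for i u
          using ball_vals_below_total[of u ?w b \<beta>] M_A[OF u(1)] M_mono[OF u(1) \<kappa>(1)] u(2) \<kappa>(2) w\<kappa>
            not_le[OF \<gamma>(2) M_A(2)[OF u(1)] u(2)] by (simp add: b)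
        show "?w \<le> u" if u: "(i, u) \<in> M" "j < i" for i u
        proof (cases "i < k")
          case True
          then show ?thesis
            using ball_vals_below_total[of u ?w b \<beta>] M_A[OF u(1)] M_mono[OF u(1) \<kappa>(1)] w\<kappa>
              not_le[OF M_A(2)[OF u(1)] \<gamma>(2) u(2)] by (simp add: b)
        next
          case False
          then have "\<kappa> \<le> u"
            using M_total[OF u(1) \<kappa>(1)] by (auto simp: lt_def)
          then show ?thesis
            using w\<kappa> by (rule order.trans[rotated])
        qed
      qed simp
      then show False
        using new by blast
    next
      case False
      then have lower: "i < j" if "(i, u) \<in> M" for i u
        using that new by (metis linorder_neqE)
      let ?C = "snd ` M"
      have "\<exists>w. is_ball_val w \<and> (\<lambda>p. w (lift p)) = \<nu> j \<and> (\<forall>u\<in>?C. u \<le> w)"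
      proof (rule ball_val_above[OF \<nu>(1,2) \<phi>])
        show "?C \<noteq> {}"
          using i\<^sub>0 by auto
        show "is_ball_val w" if "w \<in> ?C" for w
          using that M_A(1) by auto
        show "w (lift p) \<le> \<nu> j p" if "w \<in> ?C" for w p
        proof -
          from that obtain i where i: "(i, w) \<in> M"
            by auto
          then show ?thesis
            using fun_cong[OF M_A(2)[OF i], of p] le_funD[OF mono(1)[OF lower[OF i]], of p] by simp
        qed
        show "w \<le> w' \<or> w' \<le> w" if "w \<in> ?C" "w' \<in> ?C" for w w'
          using that M_total by (fastforce simp: lt_def)
      qed
      then obtain w where "is_ball_val w" "(\<lambda>p. w (lift p)) = \<nu> j" "\<forall>u\<in>?C. u \<le> w"
        by blast
      then have "(j, w) \<in> M"
        using new lower by (intro insert_M) (force dest: lower order.asym)+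
      then show False
        using new by blast
    qed
  qed
  then obtain \<omega> where \<omega>: "\<And>i. (i, \<omega> i) \<in> M"
    by metis
  have "\<omega> i\<^sub>0 = w\<^sub>0"
    using M_total[OF \<omega>[of i\<^sub>0] i\<^sub>0] by (simp add: lt_def)
  then show ?thesis
    using \<omega> M_A M_mono by blast
qed

end

theorem theorem3p17:
  fixes \<iota> :: "'k::field \<Rightarrow> 'l::alg_closed_field"
    and v :: "'k \<Rightarrow> 'g::linordered_ab_group_add top"
    and v' :: "'l \<Rightarrow> 'g top"
    and \<mu> :: "'i::linorder \<Rightarrow> 'k poly fract \<Rightarrow> 'g top"
    and \<eta>\<^sub>0 :: "'l poly fract \<Rightarrow> 'g top"
    and i\<^sub>0 :: 'i
  assumes divisible: "\<And>(n::nat) (\<gamma>::'g). n > 0 \<Longrightarrow> \<exists>\<delta>. (\<Sum>k<n. \<delta>) = \<gamma>"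
    and closure: "is_algebraic_closure \<iota>"
    and v: "valuation v"
    and v': "v' \<in> valuation_extensions \<iota> v"
    and \<mu>: "\<And>i. \<mu> i \<in> valuation_extensions const_fract v"
    and increasing: "increasing_family \<mu>"
    and transcendental: "\<And>i. valuation_transcendental v (\<mu> i)"
    and \<eta>\<^sub>0: "\<eta>\<^sub>0 \<in> valuation_extensions const_fract v'"
    and restr: "restricts_to \<iota> \<eta>\<^sub>0 (\<mu> i\<^sub>0)"
  shows "\<exists>\<eta> :: 'i \<Rightarrow> 'l poly fract \<Rightarrow> 'g top.
           (\<forall>i. \<eta> i \<in> valuation_extensions const_fract v') \<and>
           increasing_family \<eta> \<and>
           \<eta> i\<^sub>0 = \<eta>\<^sub>0 \<and>
           (\<forall>i. restricts_to \<iota> (\<eta> i) (\<mu> i))"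
proof -
  have hom: "\<iota> (a + b) = \<iota> a + \<iota> b" "\<iota> (a * b) = \<iota> a * \<iota> b" "\<iota> 1 = 1" for a b
    using closure by (auto simp: is_algebraic_closure_def ring_hom_def ring_of_type_algebra_def)
  interpret v': ring_valuation v'
    using v' by (simp add: valuation_extensions_def valuation_iff_ring_valuation)
  interpret valued_closure v' \<iota> v
  proof
    show "\<exists>p. p \<noteq> 0 \<and> poly (map_poly \<iota> p) y = 0" for y
      using closure by (simp add: is_algebraic_closure_def)
    show "v' (\<iota> a) = v a" for a
      using v' by (simp add: valuation_extensions_def)
  qed (use hom divisible in auto)
  \<comment> \<open>Order and restriction concern polynomials only, so the construction takes place
    there; values on fractions are then determined.\<close>
  define \<nu> where "\<nu> i p = \<mu> i (to_fract p)" for i p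
  have \<nu>: "ring_valuation (\<nu> i)" "\<nu> i [:c:] = v c" for i c
    using valuation_restrict_poly[OF \<mu>, of i] by (simp_all add: \<nu>_def[abs_def])
  have detect: "\<exists>\<phi>. \<phi> \<noteq> 0 \<and> detects (\<nu> i) \<phi>" for i
    using detects_exists[OF \<mu> transcendental, of i] by (simp add: \<nu>_def[abs_def])
  have \<nu>_mono: "\<nu> i \<le> \<nu> j" "\<nu> i \<noteq> \<nu> j" if "i < j" for i j
  proof -
    have less: "val_less (\<mu> i) (\<mu> j)"
      using increasing that by (simp add: increasing_family_def)
    then show "\<nu> i \<le> \<nu> j"
      by (simp add: le_fun_def \<nu>_def val_less_def val_le_def)
    show "\<nu> i \<noteq> \<nu> j"
    proof
      assume eq: "\<nu> i = \<nu> j"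
      have "\<mu> i = \<mu> j"
        using \<mu>[of i] \<mu>[of j] fun_cong[OF eq]
        by (intro valuation_eq_if_eq_to_fract) (simp_all add: valuation_extensions_def \<nu>_def)
      then show False
        using less by (simp add: val_less_def)
    qed
  qed
  define w\<^sub>0 where "w\<^sub>0 p = \<eta>\<^sub>0 (to_fract p)" for p
  have w\<^sub>0: "ring_valuation w\<^sub>0" "w\<^sub>0 [:c:] = v' c" for c
    using valuation_restrict_poly[OF \<eta>\<^sub>0] by (simp_all add: w\<^sub>0_def[abs_def])
  have w\<^sub>0_lift: "(\<lambda>p. w\<^sub>0 (map_poly \<iota> p)) = \<nu> i\<^sub>0"
    using restr by (simp add: restricts_to_def w\<^sub>0_def \<nu>_def fun_eq_iff)
  \<comment> \<open>Its restriction to \<open>K[x]\<close> has a detecting polynomial, so the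
    prescribed extension is a ball valuation.\<close>
  have "is_ball_val w\<^sub>0"
    using detect[of i\<^sub>0] is_ball_val_if_detects[OF w\<^sub>0] unfolding w\<^sub>0_lift by blast
  then obtain \<omega> where \<omega>: "\<And>i. is_ball_val (\<omega> i)" "\<And>i. (\<lambda>p. \<omega> i (map_poly \<iota> p)) = \<nu> i"
    "\<And>i j. i < j \<Longrightarrow> \<omega> i \<le> \<omega> j" "\<omega> i\<^sub>0 = w\<^sub>0"
    using ball_val_family[of \<nu> w\<^sub>0 i\<^sub>0] \<nu> detect \<nu>_mono w\<^sub>0_lift by metis
  have "\<exists>\<mu>. valuation \<mu> \<and> (\<forall>p. \<mu> (to_fract p) = \<omega> i p)" for i
    using \<omega>(1) by (intro ring_valuation_extends_to_fract is_ball_val_ring_valuation)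
  then obtain \<eta> where \<eta>: "\<And>i. valuation (\<eta> i)" "\<And>i p. \<eta> i (to_fract p) = \<omega> i p"
    by metis
  have restricts: "restricts_to \<iota> (\<eta> i) (\<mu> i)" for i
    using fun_cong[OF \<omega>(2)[of i]] by (simp add: restricts_to_def \<eta> \<nu>_def)
  have "increasing_family \<eta>"
    unfolding increasing_family_def val_less_def
  proof (intro allI impI conjI)
    fix i j :: 'i
    assume "i < j"
    show "val_le (\<eta> i) (\<eta> j)"
      using le_funD[OF \<omega>(3)[OF \<open>i < j\<close>]] by (simp add: val_le_def \<eta>)
    \<comment> \<open>Strictness is inherited from the restrictions.\<close>
    show "\<eta> i \<noteq> \<eta> j"
    proof
      assume "\<eta> i = \<eta> j"
      then have "\<nu> i = \<nu> j"
        using restricts[of i] restricts[of j] by (simp add: restricts_to_def \<nu>_def fun_eq_iff)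
      then show False
        using \<nu>_mono(2)[OF \<open>i < j\<close>] by simp
    qed
  qed
  moreover have "\<eta> i \<in> valuation_extensions const_fract v'" for i
    using \<eta> is_ball_val_const[OF \<omega>(1)] by (simp add: valuation_extensions_def const_fract_def)
  moreover have "\<eta> i\<^sub>0 = \<eta>\<^sub>0"
    using \<eta> \<eta>\<^sub>0 by (intro valuation_eq_if_eq_to_fract) (simp_all add: \<omega>(4) w\<^sub>0_def valuation_extensions_def)
  ultimately show ?thesis
    using restricts by blast
qed

end
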